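(* Let $\mathbb K$ be a commutative unital ring, $\mathbb B$ an associative unital $\mathbb K$-algebra, $W$ a right $\mathbb B$-module, $\mathcal X=\mathrm{Gras}_{\mathbb B}(W)$, and let $\Gamma: D(\Gamma)\to\mathcal X$ and $\Pi_s:D(\Pi_s)\to\mathcal X$ ($s\in\mathbb K$) be the partially defined maps given in the context. Then: (i) For fixed $a,b\in\mathcal X$, the set $C_{ab}$ with the product $(xyz):=\Gamma(x,a,y,b,z)$ is a torsor (denoted $U_{ab}$). In particular, for a triple $(a,y,b)$ with $y\in C_{ab}$, $C_{ab}$ is a group with unit $y$ and multiplication $xz=\Gamma(x,a,y,b,z)$. (ii) The map $\Gamma$ is symmetric under reversal of arguments: $\Gamma(x,a,y,b,z)=\Gamma(z,b,y,a,x)$ for all $(x,a,y,b,z)\in D(\Gamma)$. In other words, $U_{ab}$ is the opposite torsor of $U_{ba}$ (same set with reversed product). In particular, the torsor $U_a:=U_{aa}$ is commutative. (iii) The commutative torsor $U_a$ is the underlying additive torsor of an affine space: for any $a\in\mathcal X$, $U_a$ is an affine space over $\mathbb K$, with additive structure given by $x+_y z=\Gamma(x,a,y,a,z)$ (sum of $x$ and $z$ with respect to the origin $y$) and action of scalars $s\in\mathbb K$ given by $sy+(1-s)x=\Pi_s(x,a,y)$ (multiplication of $y$ by $s$ with respect to the origin $x$).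
   Context: $\mathcal X=\mathrm{Gras}_{\mathbb B}(W)$ is the set of all $\mathbb B$-submodules of $W$. For $x,a\in\mathcal X$ write $x\top a$ if $W=x\oplus a$; $C_a=\{x\in\mathcal X: x\top a\}$ and $C_{ab}=C_a\cap C_b$ (these sets may be empty; torsors and affine spaces are allowed to be empty). If $x\top a$, $P_x^a:W\to W$ is the ($\mathbb B$-linear) projector onto $x$ with kernel $a$. A $\mathbb B$-linear map $f:W\to W$ acts on $\mathcal X$ by $x\mapsto f(x)$ (direct image); $[f]$ denotes its class modulo invertible scalars from $\mathbb K$, which acts on $\mathcal X$ in the same way. Define $M_{xabz}=[P_x^a-P_b^z]$ if $a\top x$, $z\top b$; $L_{xayb}=[1-P_a^xP_y^b]$ if $a\top x$, $y\top b$; $R_{aybz}=[1-P_b^zP_y^a]$ if $a\top y$, $z\top b$; $\delta_{xa}^{(s)}=[sP_a^x+P_x^a]$ if $x\top a$, $s\in\mathbb K$. Let $D_L=\{(x,a,y,b,z)\in\mathcal X^5: x\top a,\ y\top b\}$, $D_R=\{(x,a,y,b,z): y\top a,\ z\top b\}$, $D_M=\{(x,a,y,b,z): x\top a,\ z\top b,\ C_{ab}\neq\emptyset\}$, $D(\Gamma)=D_L\cup D_R\cup D_M$, and let $\Gamma(x,a,y,b,z)$ be $L_{xayb}(z)$ on $D_L$, $R_{aybz}(x)$ on $D_R$, $M_{xabz}(y)$ on $D_M$ (this is well defined). Let $D(\Pi_s)=\{(x,a,z)\in\mathcal X^3: x\top a\text{ or }z\top a\}$ and $\Pi_s(x,a,z)=\delta^{(s)}_{xa}(z)$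 if $x\top a$, $\Pi_s(x,a,z)=\delta^{(1-s)}_{za}(x)$ if $z\top a$ (well defined). A torsor is a set $G$ with a ternary map $(x,y,z)\mapsto(xyz)$ such that $(xy(zuv))=((xyz)uv)$ and $(xxy)=y=(yxx)$. Its opposite torsor is the same set with product $(x,y,z)\mapsto(zyx)$; it is commutative if $(xyz)=(zyx)$. *)

theory Defs
  imports "HOL-Algebra.Algebra"
begin

(* The library locale algebra insists on a commutative multiplication, and its locale module on a
   commutative ring of scalars. Both restrictions are removed here. *)

locale assoc_unital_algebra = module K B + B: ring B
  for K :: "('k, 'r) ring_scheme" (structure) and B :: "('k, 'b, 'm) module_scheme" (structure) +
  assumes smult_mult_left:
      "\<lbrakk>s \<in> carrier K; b \<in> carrier B; c \<in> carrier B\<rbrakk> \<Longrightarrow>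
        (s \<odot>\<^bsub>B\<^esub> b) \<otimes>\<^bsub>B\<^esub> c = s \<odot>\<^bsub>B\<^esub> (b \<otimes>\<^bsub>B\<^esub> c)"
    and smult_mult_right:
      "\<lbrakk>s \<in> carrier K; b \<in> carrier B; c \<in> carrier B\<rbrakk> \<Longrightarrow>
        b \<otimes>\<^bsub>B\<^esub> (s \<odot>\<^bsub>B\<^esub> c) = s \<odot>\<^bsub>B\<^esub> (b \<otimes>\<^bsub>B\<^esub> c)"

(* The record field of W writes the scalar on the left: b \<odot>\<^bsub>W\<^esub> w stands for the right action w.b,
   whence the order of the factors in ract_mult. The ring fields mult and one of W are not used. *)

locale right_module = B?: ring B + W?: abelian_group W
  for B :: "('b, 'r) ring_scheme" (structure) and W :: "('b, 'w, 'm) module_scheme" (structure) +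
  assumes ract_closed:
      "\<lbrakk>b \<in> carrier B; w \<in> carrier W\<rbrakk> \<Longrightarrow> b \<odot>\<^bsub>W\<^esub> w \<in> carrier W"
    and ract_add_scalar:
      "\<lbrakk>b \<in> carrier B; c \<in> carrier B; w \<in> carrier W\<rbrakk> \<Longrightarrow>
        (b \<oplus>\<^bsub>B\<^esub> c) \<odot>\<^bsub>W\<^esub> w = b \<odot>\<^bsub>W\<^esub> w \<oplus>\<^bsub>W\<^esub> c \<odot>\<^bsub>W\<^esub> w"
    and ract_add_vector:
      "\<lbrakk>b \<in> carrier B; v \<in> carrier W; w \<in> carrier W\<rbrakk> \<Longrightarrow>
        b \<odot>\<^bsub>W\<^esub> (v \<oplus>\<^bsub>W\<^esub> w) = b \<odot>\<^bsub>W\<^esub> v \<oplus>\<^bsub>W\<^esub> b \<odot>\<^bsub>W\<^esub> w"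
    and ract_mult:
      "\<lbrakk>b \<in> carrier B; c \<in> carrier B; w \<in> carrier W\<rbrakk> \<Longrightarrow>
        (b \<otimes>\<^bsub>B\<^esub> c) \<odot>\<^bsub>W\<^esub> w = c \<odot>\<^bsub>W\<^esub> (b \<odot>\<^bsub>W\<^esub> w)"
    and ract_one:
      "w \<in> carrier W \<Longrightarrow> \<one>\<^bsub>B\<^esub> \<odot>\<^bsub>W\<^esub> w = w"

definition Gras :: "('b, 'r) ring_scheme \<Rightarrow> ('b, 'w, 'm) module_scheme \<Rightarrow> 'w set set" where
  "Gras B W = {x. submodule x B W}"

definition transversal :: "('b, 'w, 'm) module_scheme \<Rightarrow> 'w set \<Rightarrow> 'w set \<Rightarrow> bool" where
  "transversal W x a \<longleftrightarrow> carrier W = x <+>\<^bsub>W\<^esub> a \<and> x \<inter> a = {\<zero>\<^bsub>W\<^esub>}"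

(* The paper's C_a is C B W a a. *)
definition C :: "('b, 'r) ring_scheme \<Rightarrow> ('b, 'w, 'm) module_scheme \<Rightarrow>
    'w set \<Rightarrow> 'w set \<Rightarrow> 'w set set" where
  "C B W a b = {x \<in> Gras B W. transversal W x a \<and> transversal W x b}"

(* proj W x a is the projector P_x^a onto x with kernel a. *)
definition proj :: "('b, 'w, 'm) module_scheme \<Rightarrow> 'w set \<Rightarrow> 'w set \<Rightarrow> 'w \<Rightarrow> 'w" where
  "proj W x a w = (THE u. u \<in> x \<and> (\<exists>v\<in>a. w = u \<oplus>\<^bsub>W\<^esub> v))"

(* The operators below represent the classes [f]. A submodule has the same image under f and under
   f times an invertible scalar, so the class acts by the direct image of any representative. *)

definition M_op :: "('b, 'w, 'm) module_scheme \<Rightarrow>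
    'w set \<Rightarrow> 'w set \<Rightarrow> 'w set \<Rightarrow> 'w set \<Rightarrow> 'w \<Rightarrow> 'w" where
  "M_op W x a b z w = proj W x a w \<ominus>\<^bsub>W\<^esub> proj W b z w"

definition L_op :: "('b, 'w, 'm) module_scheme \<Rightarrow>
    'w set \<Rightarrow> 'w set \<Rightarrow> 'w set \<Rightarrow> 'w set \<Rightarrow> 'w \<Rightarrow> 'w" where
  "L_op W x a y b w = w \<ominus>\<^bsub>W\<^esub> proj W a x (proj W y b w)"

definition R_op :: "('b, 'w, 'm) module_scheme \<Rightarrow>
    'w set \<Rightarrow> 'w set \<Rightarrow> 'w set \<Rightarrow> 'w set \<Rightarrow> 'w \<Rightarrow> 'w" where
  "R_op W a y b z w = w \<ominus>\<^bsub>W\<^esub> proj W b z (proj W y a w)"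

(* K acts on W through the structure map from K to B. *)
definition delta_op :: "('k, 'b, 'n) module_scheme \<Rightarrow> ('b, 'w, 'm) module_scheme \<Rightarrow>
    'k \<Rightarrow> 'w set \<Rightarrow> 'w set \<Rightarrow> 'w \<Rightarrow> 'w" where
  "delta_op B W s x a w =
    ((s \<odot>\<^bsub>B\<^esub> \<one>\<^bsub>B\<^esub>) \<odot>\<^bsub>W\<^esub> proj W a x w) \<oplus>\<^bsub>W\<^esub> proj W x a w"

definition D_L :: "('b, 'r) ring_scheme \<Rightarrow> ('b, 'w, 'm) module_scheme \<Rightarrow>
    ('w set \<times> 'w set \<times> 'w set \<times> 'w set \<times> 'w set) set" where
  "D_L B W = {(x, a, y, b, z). {x, a, y, b, z} \<subseteq> Gras B W \<and> transversal W x a \<and> transversal W y b}"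

definition D_R :: "('b, 'r) ring_scheme \<Rightarrow> ('b, 'w, 'm) module_scheme \<Rightarrow>
    ('w set \<times> 'w set \<times> 'w set \<times> 'w set \<times> 'w set) set" where
  "D_R B W = {(x, a, y, b, z). {x, a, y, b, z} \<subseteq> Gras B W \<and> transversal W y a \<and> transversal W z b}"

definition D_M :: "('b, 'r) ring_scheme \<Rightarrow> ('b, 'w, 'm) module_scheme \<Rightarrow>
    ('w set \<times> 'w set \<times> 'w set \<times> 'w set \<times> 'w set) set" where
  "D_M B W = {(x, a, y, b, z). {x, a, y, b, z} \<subseteq> Gras B W \<and> transversal W x a \<and> transversal W z b \<and>
     C B W a b \<noteq> {}}"

definition D_Gamma :: "('b, 'r) ring_scheme \<Rightarrow> ('b, 'w, 'm) module_scheme \<Rightarrow>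
    ('w set \<times> 'w set \<times> 'w set \<times> 'w set \<times> 'w set) set" where
  "D_Gamma B W = D_L B W \<union> D_R B W \<union> D_M B W"

(* All applicable clauses are imposed at once: no clause takes priority where the domains overlap,
   so evaluating Gamma (and likewise Pi_op below) requires that the clauses agree there. *)
definition Gamma :: "('b, 'r) ring_scheme \<Rightarrow> ('b, 'w, 'm) module_scheme \<Rightarrow>
    'w set \<Rightarrow> 'w set \<Rightarrow> 'w set \<Rightarrow> 'w set \<Rightarrow> 'w set \<Rightarrow> 'w set" where
  "Gamma B W x a y b z =
    (if (x, a, y, b, z) \<in> D_Gamma B W
     then THE u. ((x, a, y, b, z) \<in> D_L B W \<longrightarrow> u = L_op W x a y b ` z) \<and>
                 ((x, a, y, b, z) \<in> D_R B W \<longrightarrow> u = R_op W a y b z ` x) \<and>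
                 ((x, a, y, b, z) \<in> D_M B W \<longrightarrow> u = M_op W x a b z ` y)
     else undefined)"

definition D_Pi :: "('b, 'r) ring_scheme \<Rightarrow> ('b, 'w, 'm) module_scheme \<Rightarrow>
    ('w set \<times> 'w set \<times> 'w set) set" where
  "D_Pi B W = {(x, a, z). {x, a, z} \<subseteq> Gras B W \<and> (transversal W x a \<or> transversal W z a)}"

definition Pi_op :: "('k, 'r) ring_scheme \<Rightarrow> ('k, 'b, 'n) module_scheme \<Rightarrow>
    ('b, 'w, 'm) module_scheme \<Rightarrow> 'k \<Rightarrow> 'w set \<Rightarrow> 'w set \<Rightarrow> 'w set \<Rightarrow> 'w set" where
  "Pi_op K B W s x a z =
    (if (x, a, z) \<in> D_Pi B W
     then THE u. (transversal W x a \<longrightarrow> u = delta_op B W s x a ` z) \<and>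
                 (transversal W z a \<longrightarrow> u = delta_op B W (\<one>\<^bsub>K\<^esub> \<ominus>\<^bsub>K\<^esub> s) z a ` x)
     else undefined)"

locale torsor =
  fixes G :: "'a set" and t :: "'a \<Rightarrow> 'a \<Rightarrow> 'a \<Rightarrow> 'a"
  assumes t_closed: "\<lbrakk>x \<in> G; y \<in> G; z \<in> G\<rbrakk> \<Longrightarrow> t x y z \<in> G"
    and t_assoc: "\<lbrakk>x \<in> G; y \<in> G; z \<in> G; u \<in> G; v \<in> G\<rbrakk> \<Longrightarrow> t x y (t z u v) = t (t x y z) u v"
    and t_left: "\<lbrakk>x \<in> G; y \<in> G\<rbrakk> \<Longrightarrow> t x x y = y"
    and t_right: "\<lbrakk>x \<in> G; y \<in> G\<rbrakk> \<Longrightarrow> t y x x = y"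

locale commutative_torsor = torsor +
  assumes t_commute: "\<lbrakk>x \<in> G; y \<in> G; z \<in> G\<rbrakk> \<Longrightarrow> t x y z = t z y x"

definition opposite :: "('a \<Rightarrow> 'a \<Rightarrow> 'a \<Rightarrow> 'a) \<Rightarrow> 'a \<Rightarrow> 'a \<Rightarrow> 'a \<Rightarrow> 'a" where
  "opposite t x y z = t z y x"

(* The product of the torsor U_ab, whose underlying set is C B W a b. *)
definition U :: "('b, 'r) ring_scheme \<Rightarrow> ('b, 'w, 'm) module_scheme \<Rightarrow> 'w set \<Rightarrow> 'w set \<Rightarrow>
    'w set \<Rightarrow> 'w set \<Rightarrow> 'w set \<Rightarrow> 'w set" where
  "U B W a b x y z = Gamma B W x a y b z"

(* An affine space A with translation module V; A may be empty. *)
locale affine_space = module K V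
  for K :: "('k, 'r) ring_scheme" (structure) and V :: "('k, 'v, 'm) module_scheme" (structure) +
  fixes A :: "'p set" and act :: "'v \<Rightarrow> 'p \<Rightarrow> 'p"
  assumes act_closed: "\<lbrakk>v \<in> carrier V; p \<in> A\<rbrakk> \<Longrightarrow> act v p \<in> A"
    and act_zero: "p \<in> A \<Longrightarrow> act \<zero>\<^bsub>V\<^esub> p = p"
    and act_add: "\<lbrakk>v \<in> carrier V; w \<in> carrier V; p \<in> A\<rbrakk> \<Longrightarrow> act (v \<oplus>\<^bsub>V\<^esub> w) p = act v (act w p)"
    and simply_transitive: "\<lbrakk>p \<in> A; q \<in> A\<rbrakk> \<Longrightarrow> \<exists>!v. v \<in> carrier V \<and> act v p = q"

(* The vector q - p, the sum p +_e q = e + ((p - e) + (q - e)), and the multiple e + s (p - e). *)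

definition vec :: "('k, 'v, 'm) module_scheme \<Rightarrow> ('v \<Rightarrow> 'p \<Rightarrow> 'p) \<Rightarrow> 'p \<Rightarrow> 'p \<Rightarrow> 'v" where
  "vec V act p q = (THE v. v \<in> carrier V \<and> act v p = q)"

definition sum_at :: "('k, 'v, 'm) module_scheme \<Rightarrow> ('v \<Rightarrow> 'p \<Rightarrow> 'p) \<Rightarrow> 'p \<Rightarrow> 'p \<Rightarrow> 'p \<Rightarrow> 'p" where
  "sum_at V act e p q = act (vec V act e p \<oplus>\<^bsub>V\<^esub> vec V act e q) e"

definition scale_at :: "('k, 'v, 'm) module_scheme \<Rightarrow> ('v \<Rightarrow> 'p \<Rightarrow> 'p) \<Rightarrow> 'p \<Rightarrow> 'k \<Rightarrow> 'p \<Rightarrow> 'p" where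
  "scale_at V act e s p = act (s \<odot>\<^bsub>V\<^esub> vec V act e p) e"

(* The affine space structure on A whose sum p +_e q is addition e p q and whose multiple of p by s with
   respect to the origin e is scaling e s p. Taking the vectors of type 'p is no restriction: a
   nonempty affine space is in bijection with its translation module, and any module serves if A is
   empty. *)
definition is_affine_structure :: "('k, 'r) ring_scheme \<Rightarrow> 'p set \<Rightarrow>
    ('p \<Rightarrow> 'p \<Rightarrow> 'p \<Rightarrow> 'p) \<Rightarrow> ('p \<Rightarrow> 'k \<Rightarrow> 'p \<Rightarrow> 'p) \<Rightarrow> bool" where
  "is_affine_structure K A addition scaling \<longleftrightarrow>
    (\<exists>(V :: ('k, 'p) module) act. affine_space K V A act \<and>
      (\<forall>p\<in>A. \<forall>q\<in>A. \<forall>r\<in>A. addition p q r = sum_at V act p q r) \<and>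
      (\<forall>p\<in>A. \<forall>s\<in>carrier K. \<forall>q\<in>A. scaling p s q = scale_at V act p s q))"

end

theory Submission
  imports Defs
begin

text \<open>If \<open>z\<close> is complementary to \<open>a\<close> and \<open>f\<close> is a linear map with \<open>f w - w \<in> a\<close> for all \<open>w\<close>, then
  \<open>f(z)\<close> is complementary to \<open>a\<close> and its projector is \<open>f \<circ> P\<^sub>z\<^sup>a\<close>. The operators \<open>L\<close> and \<open>\<delta>\<^sup>(\<^sup>s\<^sup>)\<close> are of
  this form with respect to \<open>a\<close>, the operators \<open>R\<close> with respect to \<open>b\<close>. Since projectors with
  a common kernel satisfy \<open>P\<^sub>y\<^sup>b P\<^sub>z\<^sup>b = P\<^sub>y\<^sup>b\<close>, para-associativity is an identity between operators.
  For \<open>a = b\<close> the formula becomes \<open>P\<^sub>u\<^sup>a = P\<^sub>x\<^sup>a - P\<^sub>y\<^sup>a + P\<^sub>z\<^sup>a\<close> for \<open>u = \<Gamma>(x, a, y, a, z)\<close>, and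
  similarly \<open>P\<^sub>u\<^sup>a = s P\<^sub>z\<^sup>a + (1 - s) P\<^sub>x\<^sup>a\<close> for \<open>u = \<Pi>\<^sub>s(x, a, z)\<close>, which gives the affine structure.\<close>

section \<open>Submodules, projectors and linear operators\<close>

context right_module
begin

text \<open>Sets up the method \<open>algebra\<close> for the additive group of \<open>W\<close>, so
  that identities between sums and differences of vectors are settled by normalisation.\<close>

lemmas W_simprules [algebra abelian_group "ring.zero W" "ring.add W" "a_inv W" "a_minus W"] =
  W.a_closed W.zero_closed W.a_inv_closed W.minus_closed
  W.a_assoc W.l_zero W.l_neg W.a_comm W.minus_eq
  W.r_zero W.r_neg W.r_neg2 W.r_neg1 W.minus_add W.minus_minus W.add.inv_one W.a_lcomm

lemma diff_eq_zeroD: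
  assumes "v \<in> carrier W" "w \<in> carrier W" "v \<ominus>\<^bsub>W\<^esub> w = \<zero>\<^bsub>W\<^esub>"
  shows "v = w"
proof -
  have "v = (v \<ominus>\<^bsub>W\<^esub> w) \<oplus>\<^bsub>W\<^esub> w" using assms(1,2) by algebra
  then show ?thesis using assms by simp
qed

lemma ract_zero:
  assumes "b \<in> carrier B"
  shows "b \<odot>\<^bsub>W\<^esub> \<zero>\<^bsub>W\<^esub> = \<zero>\<^bsub>W\<^esub>"
proof -
  have "b \<odot>\<^bsub>W\<^esub> \<zero>\<^bsub>W\<^esub> \<oplus>\<^bsub>W\<^esub> b \<odot>\<^bsub>W\<^esub> \<zero>\<^bsub>W\<^esub> = b \<odot>\<^bsub>W\<^esub> \<zero>\<^bsub>W\<^esub>"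
    using assms ract_add_vector[of b "\<zero>\<^bsub>W\<^esub>" "\<zero>\<^bsub>W\<^esub>"] by simp
  then show ?thesis
    using assms ract_closed[of b "\<zero>\<^bsub>W\<^esub>"] by (metis W.add.r_cancel_one' W.zero_closed)
qed

lemma ract_neg:
  assumes "b \<in> carrier B" "w \<in> carrier W"
  shows "b \<odot>\<^bsub>W\<^esub> (\<ominus>\<^bsub>W\<^esub> w) = \<ominus>\<^bsub>W\<^esub> (b \<odot>\<^bsub>W\<^esub> w)"
proof -
  have "b \<odot>\<^bsub>W\<^esub> (\<ominus>\<^bsub>W\<^esub> w) \<oplus>\<^bsub>W\<^esub> b \<odot>\<^bsub>W\<^esub> w = \<zero>\<^bsub>W\<^esub>"
    using assms ract_add_vector[of b "\<ominus>\<^bsub>W\<^esub> w" w] ract_zero by (simp add: W.l_neg)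
  then show ?thesis
    using assms by (metis W.a_inv_closed W.minus_equality ract_closed)
qed

lemma ract_diff:
  assumes "b \<in> carrier B" "v \<in> carrier W" "w \<in> carrier W"
  shows "b \<odot>\<^bsub>W\<^esub> (v \<ominus>\<^bsub>W\<^esub> w) = b \<odot>\<^bsub>W\<^esub> v \<ominus>\<^bsub>W\<^esub> b \<odot>\<^bsub>W\<^esub> w"
  using assms by (simp add: W.minus_eq ract_add_vector ract_neg)

lemma GrasI:
  assumes "x \<subseteq> carrier W" "x \<noteq> {}"
    and "\<And>v w. \<lbrakk>v \<in> x; w \<in> x\<rbrakk> \<Longrightarrow> v \<oplus>\<^bsub>W\<^esub> w \<in> x"
    and "\<And>w. w \<in> x \<Longrightarrow> \<ominus>\<^bsub>W\<^esub> w \<in> x"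
    and "\<And>b w. \<lbrakk>b \<in> carrier B; w \<in> x\<rbrakk> \<Longrightarrow> b \<odot>\<^bsub>W\<^esub> w \<in> x"
  shows "x \<in> Gras B W"
proof -
  have "subgroup x (add_monoid W)"
    using assms by (intro W.add.subgroupI) (auto simp: a_inv_def)
  then show ?thesis
    using assms(5) by (simp add: Gras_def submodule_def submodule_axioms_def)
qed

lemma Gras_closed:
  assumes "x \<in> Gras B W"
  shows "w \<in> x \<Longrightarrow> w \<in> carrier W" "\<zero>\<^bsub>W\<^esub> \<in> x"
    "\<lbrakk>v \<in> x; w \<in> x\<rbrakk> \<Longrightarrow> v \<oplus>\<^bsub>W\<^esub> w \<in> x"
    "w \<in> x \<Longrightarrow> \<ominus>\<^bsub>W\<^esub> w \<in> x"
    "\<lbrakk>v \<in> x; w \<in> x\<rbrakk> \<Longrightarrow> v \<ominus>\<^bsub>W\<^esub> w \<in> x"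
    "\<lbrakk>b \<in> carrier B; w \<in> x\<rbrakk> \<Longrightarrow> b \<odot>\<^bsub>W\<^esub> w \<in> x"
proof -
  interpret x: submodule x B W using assms by (simp add: Gras_def)
  show 1: "w \<in> x \<Longrightarrow> w \<in> carrier W" "\<zero>\<^bsub>W\<^esub> \<in> x"
    and 2: "\<lbrakk>v \<in> x; w \<in> x\<rbrakk> \<Longrightarrow> v \<oplus>\<^bsub>W\<^esub> w \<in> x" for v w
    using x.subset x.one_closed x.m_closed by auto
  show 3: "w \<in> x \<Longrightarrow> \<ominus>\<^bsub>W\<^esub> w \<in> x" for w
    using x.m_inv_closed by (simp add: a_inv_def)
  show "\<lbrakk>v \<in> x; w \<in> x\<rbrakk> \<Longrightarrow> v \<ominus>\<^bsub>W\<^esub> w \<in> x"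
    using 2 3 by (simp add: W.minus_eq)
  show "\<lbrakk>b \<in> carrier B; w \<in> x\<rbrakk> \<Longrightarrow> b \<odot>\<^bsub>W\<^esub> w \<in> x"
    using x.smult_closed by simp
qed

section \<open>Complements and their projectors\<close>

text \<open>The two remaining inclusions in \<open>transversal\<close> hold for any submodules,
  which lie in the carrier and contain zero; what is left is existence and uniqueness of
  decompositions.\<close>

lemma transversal_iff:
  assumes "x \<in> Gras B W" "a \<in> Gras B W"
  shows "transversal W x a \<longleftrightarrow>
    (\<forall>w\<in>carrier W. \<exists>u\<in>x. \<exists>v\<in>a. w = u \<oplus>\<^bsub>W\<^esub> v) \<and> (\<forall>w\<in>x. w \<in> a \<longrightarrow> w = \<zero>\<^bsub>W\<^esub>)"
  using Gras_closed(1,2)[OF assms(1)] Gras_closed(1,2)[OF assms(2)]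
  by (auto simp: transversal_def set_add_def')

lemma transversal_sym:
  assumes "x \<in> Gras B W" "a \<in> Gras B W" "transversal W x a"
  shows "transversal W a x"
  using assms(3) unfolding transversal_iff[OF assms(1,2)] transversal_iff[OF assms(2,1)]
  by (metis W.a_comm Gras_closed(1) assms(1,2))

text \<open>Two decompositions of one vector differ by an element of both \<open>x\<close> and
  \<open>a\<close>, hence by zero. This resolves the definite description in \<open>proj\<close>:
  any decomposition that can be written down computes the projection.\<close>

lemma proj_eqI:
  assumes "x \<in> Gras B W" "a \<in> Gras B W" "transversal W x a" "u \<in> x" "v \<in> a" "w = u \<oplus>\<^bsub>W\<^esub> v"
  shows "proj W x a w = u"
  unfolding proj_def
proof (rule the_equality)
  show "u \<in> x \<and> (\<exists>v\<in>a. w = u \<oplus>\<^bsub>W\<^esub> v)" using assms by blast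
  fix u' assume "u' \<in> x \<and> (\<exists>v\<in>a. w = u' \<oplus>\<^bsub>W\<^esub> v)"
  then obtain v' where u': "u' \<in> x" "v' \<in> a" "w = u' \<oplus>\<^bsub>W\<^esub> v'" by blast
  note c = Gras_closed(1)[OF assms(1) u'(1)] Gras_closed(1)[OF assms(1,4)]
    Gras_closed(1)[OF assms(2) u'(2)] Gras_closed(1)[OF assms(2,5)]
  have "u' \<ominus>\<^bsub>W\<^esub> u = (u' \<oplus>\<^bsub>W\<^esub> v') \<ominus>\<^bsub>W\<^esub> v' \<ominus>\<^bsub>W\<^esub> u" using c by algebra
  also have "\<dots> = (u \<oplus>\<^bsub>W\<^esub> v) \<ominus>\<^bsub>W\<^esub> v' \<ominus>\<^bsub>W\<^esub> u" using assms(6) u'(3) by simp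
  also have "\<dots> = v \<ominus>\<^bsub>W\<^esub> v'" using c by algebra
  finally have "u' \<ominus>\<^bsub>W\<^esub> u \<in> a" using Gras_closed(5)[OF assms(2,5) u'(2)] by simp
  moreover have "u' \<ominus>\<^bsub>W\<^esub> u \<in> x" using Gras_closed(5)[OF assms(1) u'(1) assms(4)] .
  ultimately have "u' \<ominus>\<^bsub>W\<^esub> u = \<zero>\<^bsub>W\<^esub>" using assms(1-3) transversal_iff by blast
  then show "u' = u" using c diff_eq_zeroD by blast
qed

lemma proj_decomp:
  assumes "x \<in> Gras B W" "a \<in> Gras B W" "transversal W x a" "w \<in> carrier W"
  shows "proj W x a w \<in> x" "proj W a x w \<in> a" "proj W a x w = w \<ominus>\<^bsub>W\<^esub> proj W x a w"
proof -
  obtain u v where uv: "u \<in> x" "v \<in> a" "w = u \<oplus>\<^bsub>W\<^esub> v"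
    using assms transversal_iff by meson
  note c = Gras_closed(1)[OF assms(1) uv(1)] Gras_closed(1)[OF assms(2) uv(2)]
  have u: "proj W x a w = u" using proj_eqI[OF assms(1-3) uv] .
  have v: "proj W a x w = v"
    using uv c by (intro proj_eqI[OF assms(2,1) transversal_sym[OF assms(1-3)]]) (auto simp: W.a_comm)
  show "proj W x a w \<in> x" "proj W a x w \<in> a" using u v uv by auto
  show "proj W a x w = w \<ominus>\<^bsub>W\<^esub> proj W x a w"
    unfolding u v unfolding uv(3) using c by algebra
qed

lemma proj_id:
  assumes "x \<in> Gras B W" "a \<in> Gras B W" "transversal W x a" "w \<in> x"
  shows "proj W x a w = w"
  using Gras_closed(1)[OF assms(1,4)]
  by (intro proj_eqI[OF assms Gras_closed(2)[OF assms(2)]]) simp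

lemma proj_zero:
  assumes "x \<in> Gras B W" "a \<in> Gras B W" "transversal W x a" "w \<in> a"
  shows "proj W x a w = \<zero>\<^bsub>W\<^esub>"
  using Gras_closed(1)[OF assms(2,4)]
  by (intro proj_eqI[OF assms(1-3) Gras_closed(2)[OF assms(1)] assms(4)]) simp

section \<open>Linear operators and shears\<close>

definition linear_op where
  "linear_op f \<longleftrightarrow> f \<in> carrier W \<rightarrow> carrier W \<and>
    (\<forall>v\<in>carrier W. \<forall>w\<in>carrier W. f (v \<oplus>\<^bsub>W\<^esub> w) = f v \<oplus>\<^bsub>W\<^esub> f w) \<and>
    (\<forall>b\<in>carrier B. \<forall>w\<in>carrier W. f (b \<odot>\<^bsub>W\<^esub> w) = b \<odot>\<^bsub>W\<^esub> f w)"

lemma linear_op_closed: "linear_op f \<Longrightarrow> w \<in> carrier W \<Longrightarrow> f w \<in> carrier W"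
  by (auto simp: linear_op_def)

lemma linear_op_add:
  "linear_op f \<Longrightarrow> v \<in> carrier W \<Longrightarrow> w \<in> carrier W \<Longrightarrow> f (v \<oplus>\<^bsub>W\<^esub> w) = f v \<oplus>\<^bsub>W\<^esub> f w"
  by (auto simp: linear_op_def)

lemma linear_op_ract:
  "linear_op f \<Longrightarrow> b \<in> carrier B \<Longrightarrow> w \<in> carrier W \<Longrightarrow> f (b \<odot>\<^bsub>W\<^esub> w) = b \<odot>\<^bsub>W\<^esub> f w"
  by (auto simp: linear_op_def)

lemma linear_op_zero:
  assumes "linear_op f"
  shows "f \<zero>\<^bsub>W\<^esub> = \<zero>\<^bsub>W\<^esub>"
proof -
  have "f \<zero>\<^bsub>W\<^esub> \<oplus>\<^bsub>W\<^esub> f \<zero>\<^bsub>W\<^esub> = f \<zero>\<^bsub>W\<^esub>"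
    using linear_op_add[OF assms, of "\<zero>\<^bsub>W\<^esub>" "\<zero>\<^bsub>W\<^esub>"] by simp
  then show ?thesis
    using linear_op_closed[OF assms W.zero_closed] by (metis W.add.r_cancel_one')
qed

lemma linear_op_neg:
  assumes "linear_op f" "w \<in> carrier W"
  shows "f (\<ominus>\<^bsub>W\<^esub> w) = \<ominus>\<^bsub>W\<^esub> f w"
proof -
  have "f (\<ominus>\<^bsub>W\<^esub> w) \<oplus>\<^bsub>W\<^esub> f w = \<zero>\<^bsub>W\<^esub>"
    using assms by (simp add: W.l_neg linear_op_zero flip: linear_op_add)
  then show ?thesis
    using assms by (metis W.a_inv_closed W.minus_equality linear_op_closed)
qed

lemma linear_op_minus:
  assumes "linear_op f" "v \<in> carrier W" "w \<in> carrier W"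
  shows "f (v \<ominus>\<^bsub>W\<^esub> w) = f v \<ominus>\<^bsub>W\<^esub> f w"
  using assms by (simp add: W.minus_eq linear_op_add linear_op_neg)

lemma linear_op_id: "linear_op (\<lambda>w. w)"
  by (simp add: linear_op_def)

lemma linear_op_comp: "linear_op f \<Longrightarrow> linear_op g \<Longrightarrow> linear_op (\<lambda>w. f (g w))"
  by (auto simp: linear_op_def Pi_iff)

lemma linear_op_plus:
  assumes "linear_op f" "linear_op g"
  shows "linear_op (\<lambda>w. f w \<oplus>\<^bsub>W\<^esub> g w)"
  unfolding linear_op_def
proof (intro conjI ballI)
  note c = linear_op_closed[OF assms(1)] linear_op_closed[OF assms(2)]
  show "(\<lambda>w. f w \<oplus>\<^bsub>W\<^esub> g w) \<in> carrier W \<rightarrow> carrier W" using c by simp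
  fix v w assume vw: "v \<in> carrier W" "w \<in> carrier W"
  note c' = c[OF vw(1)] c[OF vw(2)]
  show "f (v \<oplus>\<^bsub>W\<^esub> w) \<oplus>\<^bsub>W\<^esub> g (v \<oplus>\<^bsub>W\<^esub> w) = f v \<oplus>\<^bsub>W\<^esub> g v \<oplus>\<^bsub>W\<^esub> (f w \<oplus>\<^bsub>W\<^esub> g w)"
    unfolding linear_op_add[OF assms(1) vw] linear_op_add[OF assms(2) vw] using c' by algebra
next
  fix b w assume bw: "b \<in> carrier B" "w \<in> carrier W"
  then show "f (b \<odot>\<^bsub>W\<^esub> w) \<oplus>\<^bsub>W\<^esub> g (b \<odot>\<^bsub>W\<^esub> w) = b \<odot>\<^bsub>W\<^esub> (f w \<oplus>\<^bsub>W\<^esub> g w)"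
    using assms by (simp add: linear_op_ract ract_add_vector linear_op_closed)
qed

lemma linear_op_uminus:
  assumes "linear_op f"
  shows "linear_op (\<lambda>w. \<ominus>\<^bsub>W\<^esub> f w)"
  unfolding linear_op_def
  using assms by (auto simp: linear_op_add linear_op_ract linear_op_closed W.minus_add ract_neg)

lemma linear_op_diff:
  assumes "linear_op f" "linear_op g"
  shows "linear_op (\<lambda>w. f w \<ominus>\<^bsub>W\<^esub> g w)"
  unfolding W.minus_eq by (intro linear_op_plus linear_op_uminus assms)

text \<open>Decompositions may be added and multiplied by scalars, and by uniqueness the results are
  the decompositions of the sum and of the multiple.\<close>

lemma linear_op_proj:
  assumes "x \<in> Gras B W" "a \<in> Gras B W" "transversal W x a"
  shows "linear_op (proj W x a)"
  unfolding linear_op_def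
proof (intro conjI ballI)
  note d = proj_decomp[OF assms]
  have c: "proj W x a w \<in> carrier W" if "w \<in> carrier W" for w
    using d(1)[OF that] Gras_closed(1)[OF assms(1)] by simp
  then show "proj W x a \<in> carrier W \<rightarrow> carrier W" by simp
  have diff: "w \<ominus>\<^bsub>W\<^esub> proj W x a w \<in> a" if "w \<in> carrier W" for w
    using d(2,3)[OF that] by simp
  show "proj W x a (v \<oplus>\<^bsub>W\<^esub> w) = proj W x a v \<oplus>\<^bsub>W\<^esub> proj W x a w"
    if vw: "v \<in> carrier W" "w \<in> carrier W" for v w
  proof (rule proj_eqI[OF assms])
    show "proj W x a v \<oplus>\<^bsub>W\<^esub> proj W x a w \<in> x"
      using d(1) vw Gras_closed(3)[OF assms(1)] by simp
    show "(v \<ominus>\<^bsub>W\<^esub> proj W x a v) \<oplus>\<^bsub>W\<^esub> (w \<ominus>\<^bsub>W\<^esub> proj W x a w) \<in> a"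
      using diff vw Gras_closed(3)[OF assms(2)] by simp
    show "v \<oplus>\<^bsub>W\<^esub> w = (proj W x a v \<oplus>\<^bsub>W\<^esub> proj W x a w) \<oplus>\<^bsub>W\<^esub>
      ((v \<ominus>\<^bsub>W\<^esub> proj W x a v) \<oplus>\<^bsub>W\<^esub> (w \<ominus>\<^bsub>W\<^esub> proj W x a w))"
      using c[OF vw(1)] c[OF vw(2)] vw by algebra
  qed
  show "proj W x a (b \<odot>\<^bsub>W\<^esub> w) = b \<odot>\<^bsub>W\<^esub> proj W x a w"
    if bw: "b \<in> carrier B" "w \<in> carrier W" for b w
  proof (rule proj_eqI[OF assms])
    show "b \<odot>\<^bsub>W\<^esub> proj W x a w \<in> x"
      using d(1) bw Gras_closed(6)[OF assms(1)] by simp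
    show "b \<odot>\<^bsub>W\<^esub> w \<ominus>\<^bsub>W\<^esub> b \<odot>\<^bsub>W\<^esub> proj W x a w \<in> a"
      using diff[OF bw(2)] bw c Gras_closed(6)[OF assms(2)] by (metis ract_diff)
    show "b \<odot>\<^bsub>W\<^esub> w = b \<odot>\<^bsub>W\<^esub> proj W x a w \<oplus>\<^bsub>W\<^esub> (b \<odot>\<^bsub>W\<^esub> w \<ominus>\<^bsub>W\<^esub> b \<odot>\<^bsub>W\<^esub> proj W x a w)"
      using ract_closed[OF bw] ract_closed[OF bw(1) c[OF bw(2)]] by algebra
  qed
qed

lemma image_Gras:
  assumes "linear_op f" "x \<in> Gras B W"
  shows "f ` x \<in> Gras B W"
proof (rule GrasI)
  note c = Gras_closed[OF assms(2)]
  show "f ` x \<subseteq> carrier W" using c(1) linear_op_closed[OF assms(1)] by blast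
  show "f ` x \<noteq> {}" using c(2) by blast
  show "v \<oplus>\<^bsub>W\<^esub> w \<in> f ` x" if "v \<in> f ` x" "w \<in> f ` x" for v w
    using that c(1) by (auto simp flip: linear_op_add[OF assms(1)] intro!: imageI c(3))
  show "\<ominus>\<^bsub>W\<^esub> w \<in> f ` x" if "w \<in> f ` x" for w
    using that c(1) by (auto simp flip: linear_op_neg[OF assms(1)] intro!: imageI c(4))
  show "b \<odot>\<^bsub>W\<^esub> w \<in> f ` x" if "b \<in> carrier B" "w \<in> f ` x" for b w
    using that c(1) by (auto simp flip: linear_op_ract[OF assms(1)] intro!: imageI c(6))
qed

text \<open>Modulo \<open>a\<close> the map \<open>f\<close> is the identity, so replacing the
  component of \<open>w\<close> in \<open>z\<close> by its image under \<open>f\<close> changes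
  \<open>w\<close> only by an element of \<open>a\<close>. The decomposition along \<open>z\<close>
  and \<open>a\<close> thus turns into one along the image of \<open>z\<close> and
  \<open>a\<close>.\<close>

lemma shear:
  assumes f: "linear_op f" "\<And>w. w \<in> carrier W \<Longrightarrow> f w \<ominus>\<^bsub>W\<^esub> w \<in> a"
    and z: "z \<in> Gras B W" "a \<in> Gras B W" "transversal W z a"
  shows "transversal W (f ` z) a"
    and "w \<in> carrier W \<Longrightarrow> proj W (f ` z) a w = f (proj W z a w)"
proof -
  note fz = image_Gras[OF f(1) z(1)]
  have dec: "f (proj W z a w) \<in> f ` z" "w \<ominus>\<^bsub>W\<^esub> f (proj W z a w) \<in> a"
      "w = f (proj W z a w) \<oplus>\<^bsub>W\<^esub> (w \<ominus>\<^bsub>W\<^esub> f (proj W z a w))" if w: "w \<in> carrier W" for w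
  proof -
    note d = proj_decomp[OF z w]
    note p = Gras_closed(1)[OF z(1) d(1)]
    note fp = linear_op_closed[OF f(1) p]
    show "f (proj W z a w) \<in> f ` z" using d(1) by blast
    have "(w \<ominus>\<^bsub>W\<^esub> proj W z a w) \<ominus>\<^bsub>W\<^esub> (f (proj W z a w) \<ominus>\<^bsub>W\<^esub> proj W z a w) \<in> a"
      using d(2,3) f(2)[OF p] Gras_closed(5)[OF z(2)] by simp
    moreover have "(w \<ominus>\<^bsub>W\<^esub> proj W z a w) \<ominus>\<^bsub>W\<^esub> (f (proj W z a w) \<ominus>\<^bsub>W\<^esub> proj W z a w) =
        w \<ominus>\<^bsub>W\<^esub> f (proj W z a w)"
      using w p fp by algebra
    ultimately show "w \<ominus>\<^bsub>W\<^esub> f (proj W z a w) \<in> a" by simp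
    show "w = f (proj W z a w) \<oplus>\<^bsub>W\<^esub> (w \<ominus>\<^bsub>W\<^esub> f (proj W z a w))"
      using w fp by algebra
  qed
  \<comment> \<open>If \<open>v = f u\<close> lies in \<open>a\<close>, then so does
    \<open>u\<close>, because \<open>f u\<close> and \<open>u\<close> differ by an element of
    \<open>a\<close>; but \<open>z\<close> meets \<open>a\<close> only in zero.\<close>
  have "v = \<zero>\<^bsub>W\<^esub>" if v: "v \<in> f ` z" "v \<in> a" for v
  proof -
    obtain u where u: "u \<in> z" "v = f u" using v by blast
    note c = Gras_closed(1)[OF z(1) u(1)]
    have "v \<ominus>\<^bsub>W\<^esub> (f u \<ominus>\<^bsub>W\<^esub> u) \<in> a" using v f(2)[OF c] Gras_closed(5)[OF z(2)] by simp
    moreover have "v \<ominus>\<^bsub>W\<^esub> (f u \<ominus>\<^bsub>W\<^esub> u) = u"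
      unfolding u(2) using c linear_op_closed[OF f(1) c] by algebra
    ultimately have "u = \<zero>\<^bsub>W\<^esub>" using u z transversal_iff by metis
    then show ?thesis using u linear_op_zero[OF f(1)] by simp
  qed
  then show tr: "transversal W (f ` z) a"
    unfolding transversal_iff[OF fz z(2)] using dec by (intro conjI ballI impI bexI)
  show "w \<in> carrier W \<Longrightarrow> proj W (f ` z) a w = f (proj W z a w)"
    using proj_eqI[OF fz z(2) tr dec] .
qed

section \<open>Projectors with a common kernel\<close>

text \<open>The vector \<open>w\<close> and its projection along \<open>b\<close> differ by an
  element of \<open>b\<close>, which \<open>proj W y b\<close> annihilates.\<close>

lemma proj_proj:
  assumes "b \<in> Gras B W" "y \<in> Gras B W" "z \<in> Gras B W" "transversal W y b" "transversal W z b"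
    and w: "w \<in> carrier W"
  shows "proj W y b (proj W z b w) = proj W y b w"
proof -
  note d = proj_decomp[OF assms(3,1,5) w]
  note c = Gras_closed(1)[OF assms(3) d(1)]
  note lin = linear_op_proj[OF assms(2,1,4)]
  have "proj W y b (proj W b z w) = \<zero>\<^bsub>W\<^esub>"
    using proj_zero[OF assms(2,1,4) d(2)] .
  then have "proj W y b w \<ominus>\<^bsub>W\<^esub> proj W y b (proj W z b w) = \<zero>\<^bsub>W\<^esub>"
    unfolding d(3) using linear_op_minus[OF lin w c] by simp
  then show ?thesis
    using linear_op_closed[OF lin] w c by (metis diff_eq_zeroD)
qed

text \<open>By \<open>proj_proj\<close>, projections along \<open>b\<close> identify any two
  complements of \<open>b\<close>, with \<open>proj W y b\<close> as the inverse identification. It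
  serves to parametrise \<open>z\<close> by \<open>y\<close> when images of different submodules
  have to be compared.\<close>

lemma image_proj:
  assumes "b \<in> Gras B W" "y \<in> Gras B W" "z \<in> Gras B W" "transversal W y b" "transversal W z b"
  shows "proj W z b ` y = z"
proof
  show "proj W z b ` y \<subseteq> z"
    using proj_decomp(1)[OF assms(3,1,5)] Gras_closed(1)[OF assms(2)] by blast
  show "z \<subseteq> proj W z b ` y"
  proof
    fix w assume w: "w \<in> z"
    note c = Gras_closed(1)[OF assms(3) w]
    have "proj W z b (proj W y b w) = w"
      using proj_proj[OF assms(1,3,2,5,4) c] proj_id[OF assms(3,1,5) w] by simp
    then show "w \<in> proj W z b ` y" using proj_decomp(1)[OF assms(2,1,4) c] by (metis image_eqI)
  qed
qed


lemma proj_closed: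
  assumes "x \<in> Gras B W" "a \<in> Gras B W" "transversal W x a" "w \<in> carrier W"
  shows "proj W x a w \<in> carrier W" "proj W a x w \<in> carrier W"
  using proj_decomp(1,2)[OF assms] Gras_closed(1) assms(1,2) by blast+

section \<open>The torsors $U_{ab}$\<close>

lemma L_image_eq_M_image:
  assumes "{x, a, y, b, z} \<subseteq> Gras B W"
    and "transversal W x a" "transversal W y b" "transversal W z b"
  shows "L_op W x a y b ` z = M_op W x a b z ` y"
proof -
  have G: "x \<in> Gras B W" "a \<in> Gras B W" "y \<in> Gras B W" "b \<in> Gras B W" "z \<in> Gras B W"
    using assms(1) by auto
  have "L_op W x a y b (proj W z b w) = M_op W x a b z w" if w: "w \<in> y" for w
  proof -
    have c: "w \<in> carrier W" using Gras_closed(1)[OF G(3) w] .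
    have "proj W y b (proj W z b w) = w"
      using proj_proj[OF G(4,3,5) assms(3,4) c] proj_id[OF G(3,4) assms(3) w] by simp
    then have "L_op W x a y b (proj W z b w) = proj W z b w \<ominus>\<^bsub>W\<^esub> proj W a x w"
      by (simp add: L_op_def)
    also have "\<dots> = proj W z b w \<ominus>\<^bsub>W\<^esub> (w \<ominus>\<^bsub>W\<^esub> proj W x a w)"
      using proj_decomp(3)[OF G(1,2) assms(2) c] by simp
    also have "\<dots> = proj W x a w \<ominus>\<^bsub>W\<^esub> (w \<ominus>\<^bsub>W\<^esub> proj W z b w)"
      using c proj_closed(1)[OF G(1,2) assms(2) c] proj_closed(1)[OF G(5,4) assms(4) c] by algebra
    also have "\<dots> = M_op W x a b z w"
      using proj_decomp(3)[OF G(5,4) assms(4) c] by (simp add: M_op_def)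
    finally show ?thesis .
  qed
  then have "L_op W x a y b ` proj W z b ` y = M_op W x a b z ` y"
    by (simp add: image_image)
  then show ?thesis
    using image_proj[OF G(4,3,5) assms(3,4)] by simp
qed

text \<open>Reduces all work on \<open>R_op\<close> to \<open>L_op\<close> with the arguments
  reversed.\<close>

lemma R_op_eq_L_op: "R_op W a y b z = L_op W z b y a"
  by (simp add: fun_eq_iff R_op_def L_op_def)

text \<open>Both sides are the sum of \<open>proj W x a w\<close> and \<open>proj W z b w\<close>
  minus \<open>w\<close>, an expression symmetric under the reversal.\<close>

lemma M_op_swap:
  assumes "{x, a, b, z} \<subseteq> Gras B W" "transversal W x a" "transversal W z b" "w \<in> carrier W"
  shows "M_op W x a b z w = M_op W z b a x w"
proof -
  have G: "x \<in> Gras B W" "a \<in> Gras B W" "b \<in> Gras B W" "z \<in> Gras B W"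
    using assms(1) by auto
  note c = proj_closed(1)[OF G(1,2) assms(2,4)] proj_closed(1)[OF G(4,3) assms(3,4)]
  show ?thesis
    unfolding M_op_def proj_decomp(3)[OF G(1,2) assms(2,4)] proj_decomp(3)[OF G(4,3) assms(3,4)]
    using c assms(4) by algebra
qed

lemma R_image_eq_M_image:
  assumes "{x, a, y, b, z} \<subseteq> Gras B W"
    and "transversal W x a" "transversal W y a" "transversal W z b"
  shows "R_op W a y b z ` x = M_op W x a b z ` y"
proof -
  have "R_op W a y b z ` x = M_op W z b a x ` y"
    unfolding R_op_eq_L_op by (rule L_image_eq_M_image) (use assms in auto)
  also have "\<dots> = M_op W x a b z ` y"
    using assms Gras_closed(1)[of y] by (intro image_cong refl M_op_swap) auto
  finally show ?thesis .
qed

section \<open>Evaluation and reversal of \<open>Gamma\<close>\<close>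

text \<open>The definite description in \<open>Gamma\<close> has a solution only if all applicable
  clauses agree. Where \<open>D_L\<close> and \<open>D_R\<close> overlap, all four transversality
  conditions hold, so both images can be compared with that of \<open>M_op\<close>.\<close>

lemma Gamma_eq_L:
  assumes "(x, a, y, b, z) \<in> D_L B W"
  shows "Gamma B W x a y b z = L_op W x a y b ` z"
proof -
  have G: "{x, a, y, b, z} \<subseteq> Gras B W" and T: "transversal W x a" "transversal W y b"
    using assms by (auto simp: D_L_def)
  have M: "L_op W x a y b ` z = M_op W x a b z ` y" if "transversal W z b"
    using L_image_eq_M_image[OF G T that] .
  have R: "L_op W x a y b ` z = R_op W a y b z ` x" if "(x, a, y, b, z) \<in> D_R B W"
    using that M R_image_eq_M_image[OF G T(1)] by (simp add: D_R_def)
  have "(x, a, y, b, z) \<in> D_Gamma B W" using assms by (simp add: D_Gamma_def)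
  then show ?thesis
    unfolding Gamma_def using assms R M
    by (simp only: if_True) (rule the_equality, auto simp: D_M_def)
qed

lemma Gamma_eq_R:
  assumes "(x, a, y, b, z) \<in> D_R B W"
  shows "Gamma B W x a y b z = R_op W a y b z ` x"
proof -
  have G: "{x, a, y, b, z} \<subseteq> Gras B W" and T: "transversal W y a" "transversal W z b"
    using assms by (auto simp: D_R_def)
  have M: "R_op W a y b z ` x = M_op W x a b z ` y" if "transversal W x a"
    using R_image_eq_M_image[OF G that T] .
  have L: "R_op W a y b z ` x = L_op W x a y b ` z" if "(x, a, y, b, z) \<in> D_L B W"
    using that M L_image_eq_M_image[OF G _ _ T(2)] by (simp add: D_L_def)
  have "(x, a, y, b, z) \<in> D_Gamma B W" using assms by (simp add: D_Gamma_def)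
  then show ?thesis
    unfolding Gamma_def using assms L M
    by (simp only: if_True) (rule the_equality, auto simp: D_M_def)
qed

lemma Gamma_eq_M:
  assumes "(x, a, y, b, z) \<in> D_M B W"
  shows "Gamma B W x a y b z = M_op W x a b z ` y"
proof -
  have G: "{x, a, y, b, z} \<subseteq> Gras B W" and T: "transversal W x a" "transversal W z b"
    using assms by (auto simp: D_M_def)
  have R: "R_op W a y b z ` x = M_op W x a b z ` y" if "transversal W y a"
    using R_image_eq_M_image[OF G T(1) that T(2)] .
  have L: "L_op W x a y b ` z = M_op W x a b z ` y" if "transversal W y b"
    using L_image_eq_M_image[OF G T(1) that T(2)] .
  have "(x, a, y, b, z) \<in> D_Gamma B W" using assms by (simp add: D_Gamma_def)
  then show ?thesis
    unfolding Gamma_def using assms L R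
    by (simp only: if_True) (rule the_equality, auto simp: D_L_def D_R_def)
qed

text \<open>Reversal exchanges \<open>D_L\<close> with \<open>D_R\<close> together with their
  operators, and it preserves \<open>D_M\<close>, where \<open>M_op\<close> is symmetric.\<close>

lemma Gamma_reverse:
  assumes "(x, a, y, b, z) \<in> D_Gamma B W"
  shows "(z, b, y, a, x) \<in> D_Gamma B W" "Gamma B W x a y b z = Gamma B W z b y a x"
proof -
  have L: "(z, b, y, a, x) \<in> D_R B W \<longleftrightarrow> (x, a, y, b, z) \<in> D_L B W"
    and R: "(z, b, y, a, x) \<in> D_L B W \<longleftrightarrow> (x, a, y, b, z) \<in> D_R B W"
    and M: "(z, b, y, a, x) \<in> D_M B W \<longleftrightarrow> (x, a, y, b, z) \<in> D_M B W"
    by (auto simp: D_R_def D_L_def D_M_def C_def)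
  show "(z, b, y, a, x) \<in> D_Gamma B W"
    using assms L R M by (auto simp: D_Gamma_def)
  consider "(x, a, y, b, z) \<in> D_L B W" | "(x, a, y, b, z) \<in> D_R B W" | "(x, a, y, b, z) \<in> D_M B W"
    using assms by (auto simp: D_Gamma_def)
  then show "Gamma B W x a y b z = Gamma B W z b y a x"
  proof cases
    case 1
    then show ?thesis using Gamma_eq_R[of z b y a x] L by (simp add: Gamma_eq_L R_op_eq_L_op)
  next
    case 2
    then show ?thesis using Gamma_eq_L[of z b y a x] R by (simp add: Gamma_eq_R R_op_eq_L_op)
  next
    case 3
    then have "M_op W x a b z ` y = M_op W z b a x ` y"
      using Gras_closed(1)[of y] by (intro image_cong refl M_op_swap) (auto simp: D_M_def)
    then show ?thesis using 3 M by (simp add: Gamma_eq_M)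
  qed
qed

section \<open>\<open>L_op\<close> as a shear along \<open>a\<close>\<close>

lemma linear_op_L_op:
  assumes "{x, a, y, b} \<subseteq> Gras B W" "transversal W x a" "transversal W y b"
  shows "linear_op (L_op W x a y b)"
proof -
  have "linear_op (proj W a x)" "linear_op (proj W y b)"
    using assms linear_op_proj transversal_sym[of x a] by simp_all
  from linear_op_diff[OF linear_op_id linear_op_comp[OF this]] show ?thesis
    by (simp add: L_op_def[abs_def])
qed

text \<open>The difference is minus a value of \<open>proj W a x\<close>. This is the hypothesis
  that \<open>shear\<close> asks for.\<close>

lemma L_op_diff:
  assumes "{x, a, y, b} \<subseteq> Gras B W" "transversal W x a" "transversal W y b" "w \<in> carrier W"
  shows "L_op W x a y b w \<ominus>\<^bsub>W\<^esub> w \<in> a"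
proof -
  have G: "x \<in> Gras B W" "a \<in> Gras B W" "y \<in> Gras B W" "b \<in> Gras B W"
    using assms(1) by auto
  note y = proj_closed(1)[OF G(3,4) assms(3,4)]
  note p = proj_decomp(2)[OF G(1,2) assms(2) y]
  have "L_op W x a y b w \<ominus>\<^bsub>W\<^esub> w = \<ominus>\<^bsub>W\<^esub> proj W a x (proj W y b w)"
    unfolding L_op_def using assms(4) Gras_closed(1)[OF G(2) p] by algebra
  then show ?thesis using Gras_closed(4)[OF G(2) p] by simp
qed

text \<open>Since \<open>L_op\<close> is a shear along \<open>a\<close>, the lemma
  \<open>shear\<close> applies to the image of \<open>z\<close>. The projector formula is what later
  computations use in place of the set \<open>Gamma B W x a y b z\<close>.\<close>

lemma Gamma_transversal:
  assumes "(x, a, y, b, z) \<in> D_L B W" "transversal W z a"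
  shows "Gamma B W x a y b z \<in> Gras B W" "transversal W (Gamma B W x a y b z) a"
    "w \<in> carrier W \<Longrightarrow> proj W (Gamma B W x a y b z) a w = L_op W x a y b (proj W z a w)"
proof -
  have G: "{x, a, y, b} \<subseteq> Gras B W" "z \<in> Gras B W" "a \<in> Gras B W"
    and T: "transversal W x a" "transversal W y b"
    using assms by (auto simp: D_L_def)
  note lin = linear_op_L_op[OF G(1) T]
  note shear = shear[OF lin L_op_diff[OF G(1) T] G(2,3) assms(2)]
  show "Gamma B W x a y b z \<in> Gras B W" "transversal W (Gamma B W x a y b z) a"
    "w \<in> carrier W \<Longrightarrow> proj W (Gamma B W x a y b z) a w = L_op W x a y b (proj W z a w)"
    unfolding Gamma_eq_L[OF assms(1)] using image_Gras[OF lin G(2)] shear by auto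
qed

lemma C_domains:
  assumes "a \<in> Gras B W" "b \<in> Gras B W" "x \<in> C B W a b" "y \<in> C B W a b" "z \<in> C B W a b"
  shows "(x, a, y, b, z) \<in> D_L B W" "(x, a, y, b, z) \<in> D_Gamma B W" "(z, b, y, a, x) \<in> D_L B W"
  using assms by (auto simp: C_def D_L_def D_Gamma_def)

lemma C_transversal:
  assumes "x \<in> C B W a b"
  shows "x \<in> Gras B W" "transversal W x a" "transversal W x b"
  using assms by (auto simp: C_def)

lemma Gamma_closed:
  assumes "a \<in> Gras B W" "b \<in> Gras B W" "x \<in> C B W a b" "y \<in> C B W a b" "z \<in> C B W a b"
  shows "Gamma B W x a y b z \<in> C B W a b"
proof -
  note D = C_domains[OF assms]
  \<comment> \<open>Transversality to \<open>b\<close> comes from that to \<open>a\<close> by reversing the arguments.\<close>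
  show ?thesis
    using Gamma_transversal(1,2)[OF D(1) C_transversal(2)[OF assms(5)]]
      Gamma_transversal(2)[OF D(3) C_transversal(3)[OF assms(3)]] Gamma_reverse(2)[OF D(2)]
    by (simp add: C_def)
qed

section \<open>Torsor axioms\<close>

text \<open>The range of \<open>proj W x b\<close> is \<open>x\<close>, which is the kernel of
  \<open>proj W a x\<close>; hence \<open>L_op W x a x b\<close> is the identity.\<close>

lemma Gamma_same_left:
  assumes "a \<in> Gras B W" "b \<in> Gras B W" "x \<in> C B W a b" "y \<in> C B W a b"
  shows "Gamma B W x a x b y = y"
proof -
  note x = C_transversal[OF assms(3)] and y = C_transversal[OF assms(4)]
  have "L_op W x a x b w = w" if "w \<in> y" for w
  proof -
    note w = Gras_closed(1)[OF y(1) that]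
    have "proj W a x (proj W x b w) = \<zero>\<^bsub>W\<^esub>"
      using proj_zero[OF assms(1) x(1) transversal_sym[OF x(1) assms(1) x(2)]]
        proj_decomp(1)[OF x(1) assms(2) x(3) w] by simp
    then show ?thesis using w by (simp add: L_op_def W.minus_eq)
  qed
  then show ?thesis
    using Gamma_eq_L[OF C_domains(1)[OF assms(1-3) assms(3,4)]] by simp
qed

text \<open>Both sides are images of \<open>v\<close>, so it suffices that the composite of the two
  \<open>L_op\<close> on the left agrees with the single \<open>L_op\<close> on the right at each
  vector of \<open>v\<close>.\<close>

lemma Gamma_assoc:
  assumes a: "a \<in> Gras B W" and b: "b \<in> Gras B W"
    and x: "x \<in> C B W a b" and y: "y \<in> C B W a b" and z: "z \<in> C B W a b"
    and u: "u \<in> C B W a b" and v: "v \<in> C B W a b"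
  shows "Gamma B W x a y b (Gamma B W z a u b v) = Gamma B W (Gamma B W x a y b z) a u b v"
proof -
  let ?w = "Gamma B W x a y b z"
  note w = Gamma_closed[OF a b x y z]
  note tx = C_transversal[OF x] and ty = C_transversal[OF y] and tz = C_transversal[OF z]
    and tu = C_transversal[OF u] and tv = C_transversal[OF v] and tw = C_transversal[OF w]
  have "L_op W x a y b (L_op W z a u b n) = L_op W ?w a u b n" if "n \<in> v" for n
  proof -
    note n = Gras_closed(1)[OF tv(1) that]
    define h where "h = proj W u b n"
    define p where "p = proj W z a h"
    have h: "h \<in> carrier W" unfolding h_def using proj_closed(1)[OF tu(1) b tu(3) n] .
    have p: "p \<in> carrier W" unfolding p_def using proj_closed(1)[OF tz(1) a tz(2) h] .
    have pa: "proj W a z h = h \<ominus>\<^bsub>W\<^esub> p"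
      unfolding p_def using proj_decomp(3)[OF tz(1) a tz(2) h] .
    note linP = linear_op_proj[OF ty(1) b ty(3)]
    note linQ = linear_op_proj[OF a tx(1) transversal_sym[OF tx(1) a tx(2)]]
    let ?F = "\<lambda>w. proj W a x (proj W y b w)"
    have lin: "linear_op ?F" using linear_op_comp[OF linQ linP] .
    note Fc = linear_op_closed[OF lin]
    \<comment> \<open>The first projector inside \<open>?F\<close> has kernel \<open>b\<close>, like
      the one defining \<open>h\<close>, so \<open>?F\<close> does not distinguish \<open>n\<close>
      from \<open>h\<close>. This makes the terms \<open>?F h\<close> cancel below.\<close>
    have Fh: "?F n = ?F h"
      unfolding h_def using proj_proj[OF b ty(1) tu(1) ty(3) tu(3) n] by simp
    have "L_op W x a y b (L_op W z a u b n) = (n \<ominus>\<^bsub>W\<^esub> (h \<ominus>\<^bsub>W\<^esub> p)) \<ominus>\<^bsub>W\<^esub> ?F (n \<ominus>\<^bsub>W\<^esub> (h \<ominus>\<^bsub>W\<^esub> p))"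
      by (simp add: L_op_def pa flip: h_def)
    also have "\<dots> = (n \<ominus>\<^bsub>W\<^esub> (h \<ominus>\<^bsub>W\<^esub> p)) \<ominus>\<^bsub>W\<^esub> (?F h \<ominus>\<^bsub>W\<^esub> (?F h \<ominus>\<^bsub>W\<^esub> ?F p))"
      using n h p by (simp add: linear_op_minus[OF lin] Fh)
    also have "\<dots> = n \<ominus>\<^bsub>W\<^esub> (h \<ominus>\<^bsub>W\<^esub> (p \<ominus>\<^bsub>W\<^esub> ?F p))"
      using n h p Fc[OF h] Fc[OF p] by algebra
    \<comment> \<open>The left side is \<open>L_op W x a y b p\<close> with \<open>p\<close> the
      projection of \<open>h\<close> onto \<open>z\<close> along \<open>a\<close>, which is the
      formula for the projector onto \<open>?w\<close>.\<close>
    also have "p \<ominus>\<^bsub>W\<^esub> ?F p = proj W ?w a h"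
      using Gamma_transversal(3)[OF C_domains(1)[OF a b x y z] tz(2) h] by (simp add: L_op_def p_def)
    also have "n \<ominus>\<^bsub>W\<^esub> (h \<ominus>\<^bsub>W\<^esub> proj W ?w a h) = L_op W ?w a u b n"
      using proj_decomp(3)[OF tw(1) a tw(2) h] by (simp add: L_op_def h_def)
    finally show ?thesis .
  qed
  then have "L_op W x a y b ` L_op W z a u b ` v = L_op W ?w a u b ` v"
    by (simp add: image_image)
  then show ?thesis
    using Gamma_eq_L[OF C_domains(1)[OF a b z u v]] Gamma_eq_L[OF C_domains(1)[OF a b w u v]]
      Gamma_eq_L[OF C_domains(1)[OF a b x y Gamma_closed[OF a b z u v]]] by simp
qed

lemma C_commute: "C B W a b = C B W b a"
  by (auto simp: C_def)

lemma torsor_U: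
  assumes a: "a \<in> Gras B W" and b: "b \<in> Gras B W"
  shows "torsor (C B W a b) (U B W a b)"
proof
  fix x y assume x: "x \<in> C B W a b" and y: "y \<in> C B W a b"
  show "U B W a b x x y = y"
    unfolding U_def using Gamma_same_left[OF a b x y] .
  \<comment> \<open>The right cancellation law is the left one for \<open>a\<close> and
    \<open>b\<close> exchanged, read backwards.\<close>
  have "Gamma B W x b x a y = y"
    using Gamma_same_left[OF b a] x y C_commute by blast
  then show "U B W a b y x x = y"
    unfolding U_def using Gamma_reverse(2)[OF C_domains(2)[OF a b y x x]] by simp
qed (use Gamma_closed[OF a b] Gamma_assoc[OF a b] in \<open>simp_all add: U_def\<close>)

lemma U_opposite:
  assumes "a \<in> Gras B W" "b \<in> Gras B W" "x \<in> C B W a b" "y \<in> C B W a b" "z \<in> C B W a b"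
  shows "U B W a b x y z = opposite (U B W b a) x y z"
  unfolding U_def opposite_def using Gamma_reverse(2)[OF C_domains(2)[OF assms]] .

lemma commutative_torsor_U:
  assumes "a \<in> Gras B W"
  shows "commutative_torsor (C B W a a) (U B W a a)"
  using torsor_U[OF assms assms] U_opposite[OF assms assms]
  by (simp add: commutative_torsor_def commutative_torsor_axioms_def opposite_def)

end

lemma (in torsor) group_at:
  assumes "y \<in> G"
  shows "group \<lparr>carrier = G, monoid.mult = (\<lambda>x z. t x y z), one = y\<rparr>"
proof (rule groupI)
  fix x assume "x \<in> carrier \<lparr>carrier = G, monoid.mult = (\<lambda>x z. t x y z), one = y\<rparr>"
  then have x: "x \<in> G" by simp
  \<comment> \<open>The inverse of \<open>x\<close> for the unit \<open>y\<close> is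
    \<open>t y x y\<close>; rebracketing leaves only expressions to which the two cancellation laws
    apply.\<close>
  have "t (t y x y) y x = t y x (t y y x)" using t_assoc[of y x y y x] assms x by simp
  also have "\<dots> = y" using t_left t_right assms x by simp
  finally show "\<exists>u\<in>carrier \<lparr>carrier = G, monoid.mult = (\<lambda>x z. t x y z), one = y\<rparr>.
      u \<otimes>\<^bsub>\<lparr>carrier = G, monoid.mult = (\<lambda>x z. t x y z), one = y\<rparr>\<^esub> x =
      \<one>\<^bsub>\<lparr>carrier = G, monoid.mult = (\<lambda>x z. t x y z), one = y\<rparr>\<^esub>"
    using t_closed[of y x y] assms x by auto
qed (use assms in \<open>simp_all add: t_closed t_left t_right t_assoc\<close>)

section \<open>The affine space $U_a$\<close>

locale module_over_algebra = assoc_unital_algebra K B + right_module B W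
  for K :: "('k, 'r) ring_scheme" and B :: "('k, 'b, 'n) module_scheme"
    and W :: "('b, 'w, 'm) module_scheme"
begin

section \<open>Scalars from \<open>K\<close> acting on \<open>W\<close>\<close>

definition smul where "smul s w = (s \<odot>\<^bsub>B\<^esub> \<one>\<^bsub>B\<^esub>) \<odot>\<^bsub>W\<^esub> w"

lemma scalar_closed: "s \<in> carrier K \<Longrightarrow> s \<odot>\<^bsub>B\<^esub> \<one>\<^bsub>B\<^esub> \<in> carrier B"
  by (rule smult_closed) simp_all

text \<open>Centrality is what makes the action of \<open>K\<close> on \<open>W\<close> commute with
  that of \<open>B\<close>, so that \<open>smul s\<close> is a linear operator.\<close>

lemma scalar_central:
  assumes "s \<in> carrier K" "b \<in> carrier B"
  shows "(s \<odot>\<^bsub>B\<^esub> \<one>\<^bsub>B\<^esub>) \<otimes>\<^bsub>B\<^esub> b = b \<otimes>\<^bsub>B\<^esub> (s \<odot>\<^bsub>B\<^esub> \<one>\<^bsub>B\<^esub>)"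
  using assms by (simp add: smult_mult_left smult_mult_right)

lemma smul_closed: "s \<in> carrier K \<Longrightarrow> w \<in> carrier W \<Longrightarrow> smul s w \<in> carrier W"
  by (simp add: smul_def ract_closed scalar_closed)

lemma linear_op_smul:
  assumes "s \<in> carrier K"
  shows "linear_op (smul s)"
  unfolding linear_op_def
proof (intro conjI ballI)
  show "smul s \<in> carrier W \<rightarrow> carrier W" using smul_closed[OF assms] by simp
  show "smul s (v \<oplus>\<^bsub>W\<^esub> w) = smul s v \<oplus>\<^bsub>W\<^esub> smul s w" if "v \<in> carrier W" "w \<in> carrier W" for v w
    unfolding smul_def using ract_add_vector[OF scalar_closed[OF assms] that] .
  show "smul s (b \<odot>\<^bsub>W\<^esub> w) = b \<odot>\<^bsub>W\<^esub> smul s w" if bw: "b \<in> carrier B" "w \<in> carrier W" for b w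
    unfolding smul_def
    using ract_mult[OF bw(1) scalar_closed[OF assms] bw(2)]
      ract_mult[OF scalar_closed[OF assms] bw] scalar_central[OF assms bw(1)] by simp
qed

lemma smul_add_scalar:
  assumes "s \<in> carrier K" "t \<in> carrier K" "w \<in> carrier W"
  shows "smul (s \<oplus>\<^bsub>K\<^esub> t) w = smul s w \<oplus>\<^bsub>W\<^esub> smul t w"
  using assms by (simp add: smul_def smult_l_distr ract_add_scalar scalar_closed)

lemma smul_mult:
  assumes "s \<in> carrier K" "t \<in> carrier K" "w \<in> carrier W"
  shows "smul (s \<otimes>\<^bsub>K\<^esub> t) w = smul s (smul t w)"
proof -
  have "(s \<otimes>\<^bsub>K\<^esub> t) \<odot>\<^bsub>B\<^esub> \<one>\<^bsub>B\<^esub> = s \<odot>\<^bsub>B\<^esub> (t \<odot>\<^bsub>B\<^esub> \<one>\<^bsub>B\<^esub>)"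
    using assms by (simp add: smult_assoc1)
  \<comment> \<open>In a right action the left factor of a product acts first, so \<open>t\<close>
    has to stand on the left.\<close>
  also have "\<dots> = (t \<odot>\<^bsub>B\<^esub> \<one>\<^bsub>B\<^esub>) \<otimes>\<^bsub>B\<^esub> (s \<odot>\<^bsub>B\<^esub> \<one>\<^bsub>B\<^esub>)"
    using assms by (simp add: smult_mult_right scalar_closed)
  finally show ?thesis
    unfolding smul_def using ract_mult[OF scalar_closed scalar_closed assms(3)] assms by simp
qed

lemma smul_one: "w \<in> carrier W \<Longrightarrow> smul \<one>\<^bsub>K\<^esub> w = w"
  by (simp add: smul_def ract_one)

lemma smul_one_minus:
  assumes "s \<in> carrier K" "w \<in> carrier W"
  shows "smul (\<one>\<^bsub>K\<^esub> \<ominus>\<^bsub>K\<^esub> s) w = w \<ominus>\<^bsub>W\<^esub> smul s w"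
proof -
  have "\<one>\<^bsub>K\<^esub> = (\<one>\<^bsub>K\<^esub> \<ominus>\<^bsub>K\<^esub> s) \<oplus>\<^bsub>K\<^esub> s" using assms(1) by algebra
  then have "w = smul (\<one>\<^bsub>K\<^esub> \<ominus>\<^bsub>K\<^esub> s) w \<oplus>\<^bsub>W\<^esub> smul s w"
    using smul_add_scalar[of "\<one>\<^bsub>K\<^esub> \<ominus>\<^bsub>K\<^esub> s" s w] smul_one[OF assms(2)] assms by simp
  moreover have "(v \<oplus>\<^bsub>W\<^esub> smul s w) \<ominus>\<^bsub>W\<^esub> smul s w = v" if "v \<in> carrier W" for v
    using that smul_closed[OF assms] by algebra
  ultimately show ?thesis using smul_closed assms by (metis R.minus_closed R.one_closed)
qed

section \<open>The map \<open>Pi_op\<close>\<close>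

text \<open>This makes the two clauses of \<open>Pi_op\<close> agree. Parametrise \<open>z\<close>
  by \<open>x\<close>, so that \<open>w\<close> in \<open>x\<close> corresponds to \<open>p\<close>
  in \<open>z\<close>: both operators yield \<open>s\<close> times \<open>p\<close> plus
  \<open>1 - s\<close> times \<open>w\<close>.\<close>

lemma delta_image_swap:
  assumes G: "a \<in> Gras B W" "x \<in> Gras B W" "z \<in> Gras B W" and T: "transversal W x a" "transversal W z a"
    and s: "s \<in> carrier K"
  shows "delta_op B W s x a ` z = delta_op B W (\<one>\<^bsub>K\<^esub> \<ominus>\<^bsub>K\<^esub> s) z a ` x"
proof -
  have "delta_op B W s x a (proj W z a w) = delta_op B W (\<one>\<^bsub>K\<^esub> \<ominus>\<^bsub>K\<^esub> s) z a w" if "w \<in> x" for w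
  proof -
    note w = Gras_closed(1)[OF G(2) that]
    define p where "p = proj W z a w"
    have p: "p \<in> carrier W" unfolding p_def using proj_closed(1)[OF G(3,1) T(2) w] .
    have xp: "proj W x a p = w"
      unfolding p_def using proj_proj[OF G(1-3) T w] proj_id[OF G(2,1) T(1) that] by simp
    have "delta_op B W s x a p = smul s (p \<ominus>\<^bsub>W\<^esub> w) \<oplus>\<^bsub>W\<^esub> w"
      using proj_decomp(3)[OF G(2,1) T(1) p] xp by (simp add: delta_op_def smul_def)
    also have "\<dots> = (smul s p \<ominus>\<^bsub>W\<^esub> smul s w) \<oplus>\<^bsub>W\<^esub> w"
      using linear_op_minus[OF linear_op_smul[OF s] p w] by simp
    also have "\<dots> = ((w \<ominus>\<^bsub>W\<^esub> p) \<ominus>\<^bsub>W\<^esub> (smul s w \<ominus>\<^bsub>W\<^esub> smul s p)) \<oplus>\<^bsub>W\<^esub> p"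
      using w p smul_closed[OF s w] smul_closed[OF s p] by algebra
    also have "\<dots> = smul (\<one>\<^bsub>K\<^esub> \<ominus>\<^bsub>K\<^esub> s) (w \<ominus>\<^bsub>W\<^esub> p) \<oplus>\<^bsub>W\<^esub> p"
      using w p linear_op_minus[OF linear_op_smul[OF s] w p] by (simp add: smul_one_minus[OF s])
    also have "\<dots> = delta_op B W (\<one>\<^bsub>K\<^esub> \<ominus>\<^bsub>K\<^esub> s) z a w"
      using proj_decomp(3)[OF G(3,1) T(2) w] by (simp add: delta_op_def smul_def p_def)
    finally show ?thesis unfolding p_def .
  qed
  then have "delta_op B W s x a ` proj W z a ` x = delta_op B W (\<one>\<^bsub>K\<^esub> \<ominus>\<^bsub>K\<^esub> s) z a ` x"
    by (simp add: image_image)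
  then show ?thesis using image_proj[OF G(1-3) T] by simp
qed

lemma Pi_op_eq:
  assumes "a \<in> Gras B W" "x \<in> C B W a a" "z \<in> C B W a a" "s \<in> carrier K"
  shows "Pi_op K B W s x a z = delta_op B W s x a ` z"
proof -
  note x = C_transversal(1,2)[OF assms(2)] and z = C_transversal(1,2)[OF assms(3)]
  have "(x, a, z) \<in> D_Pi B W" using assms(1) x z by (simp add: D_Pi_def)
  then show ?thesis
    unfolding Pi_op_def using x(2) z(2) delta_image_swap[OF assms(1) x(1) z(1) x(2) z(2) assms(4)]
    by simp
qed

lemma delta_op_alt:
  assumes "a \<in> Gras B W" "x \<in> Gras B W" "transversal W x a" "s \<in> carrier K" "w \<in> carrier W"
  shows "delta_op B W s x a w = smul s (w \<ominus>\<^bsub>W\<^esub> proj W x a w) \<oplus>\<^bsub>W\<^esub> proj W x a w"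
  using proj_decomp(3)[OF assms(2,1,3,5)] by (simp add: delta_op_def smul_def)

lemma linear_op_delta:
  assumes "a \<in> Gras B W" "x \<in> Gras B W" "transversal W x a" "s \<in> carrier K"
  shows "linear_op (delta_op B W s x a)"
proof -
  have "linear_op (proj W a x)" "linear_op (proj W x a)"
    using assms linear_op_proj transversal_sym[of x a] by simp_all
  from linear_op_plus[OF linear_op_comp[OF linear_op_smul[OF assms(4)] this(1)] this(2)] show ?thesis
    by (simp add: delta_op_def[abs_def] smul_def)
qed

text \<open>Only the component in \<open>a\<close> is multiplied by \<open>s\<close>, so a vector
  moves by an element of \<open>a\<close>, and \<open>shear\<close> becomes applicable.\<close>

lemma delta_op_diff:
  assumes "a \<in> Gras B W" "x \<in> Gras B W" "transversal W x a" "s \<in> carrier K" "w \<in> carrier W"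
  shows "delta_op B W s x a w \<ominus>\<^bsub>W\<^esub> w \<in> a"
proof -
  let ?q = "w \<ominus>\<^bsub>W\<^esub> proj W x a w"
  note p = proj_closed(1)[OF assms(2,1,3,5)]
  have q: "?q \<in> a" using proj_decomp(2,3)[OF assms(2,1,3,5)] by simp
  then have sq: "smul s ?q \<in> a"
    unfolding smul_def using Gras_closed(6)[OF assms(1) scalar_closed[OF assms(4)]] by simp
  have "delta_op B W s x a w \<ominus>\<^bsub>W\<^esub> w = smul s ?q \<ominus>\<^bsub>W\<^esub> ?q"
    unfolding delta_op_alt[OF assms] using p assms(5) Gras_closed(1)[OF assms(1) sq] by algebra
  then show ?thesis using Gras_closed(5)[OF assms(1) sq q] by simp
qed

lemma Pi_closed:
  assumes "a \<in> Gras B W" "x \<in> C B W a a" "z \<in> C B W a a" "s \<in> carrier K"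
  shows "Pi_op K B W s x a z \<in> C B W a a"
proof -
  note x = C_transversal(1,2)[OF assms(2)] and z = C_transversal(1,2)[OF assms(3)]
  note lin = linear_op_delta[OF assms(1) x assms(4)]
  show ?thesis
    unfolding Pi_op_eq[OF assms]
    using image_Gras[OF lin z(1)] shear(1)[OF lin delta_op_diff[OF assms(1) x assms(4)] z(1) assms(1) z(2)]
    by (simp add: C_def)
qed

text \<open>By \<open>shear\<close> the projector is \<open>delta_op\<close> after
  \<open>proj W z a\<close>; the inner projection drops out of \<open>proj W x a\<close> because the
  kernels agree.\<close>

lemma proj_Pi:
  assumes "a \<in> Gras B W" "x \<in> C B W a a" "z \<in> C B W a a" "s \<in> carrier K" "w \<in> carrier W"
  shows "proj W (Pi_op K B W s x a z) a w =
    smul s (proj W z a w \<ominus>\<^bsub>W\<^esub> proj W x a w) \<oplus>\<^bsub>W\<^esub> proj W x a w"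
proof -
  note x = C_transversal(1,2)[OF assms(2)] and z = C_transversal(1,2)[OF assms(3)]
  note lin = linear_op_delta[OF assms(1) x assms(4)]
  have "proj W (Pi_op K B W s x a z) a w = delta_op B W s x a (proj W z a w)"
    using shear(2)[OF lin delta_op_diff[OF assms(1) x assms(4)] z(1) assms(1) z(2) assms(5)]
    by (simp add: Pi_op_eq[OF assms(1-4)])
  then show ?thesis
    using delta_op_alt[OF assms(1) x assms(4) proj_closed(1)[OF z(1) assms(1) z(2) assms(5)]]
      proj_proj[OF assms(1) x(1) z(1) x(2) z(2) assms(5)] by simp
qed

text \<open>For \<open>a = b\<close> all projectors in \<open>L_op\<close> can be written with
  kernel \<open>a\<close>, and their products collapse by \<open>proj_proj\<close>, leaving an
  alternating sum.\<close>

lemma proj_Gamma: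
  assumes "a \<in> Gras B W" "x \<in> C B W a a" "y \<in> C B W a a" "z \<in> C B W a a" "w \<in> carrier W"
  shows "proj W (Gamma B W x a y a z) a w = (proj W x a w \<ominus>\<^bsub>W\<^esub> proj W y a w) \<oplus>\<^bsub>W\<^esub> proj W z a w"
proof -
  note x = C_transversal(1,2)[OF assms(2)] and y = C_transversal(1,2)[OF assms(3)]
    and z = C_transversal(1,2)[OF assms(4)]
  note c = proj_closed(1)[OF x(1) assms(1) x(2) assms(5)]
    proj_closed(1)[OF y(1) assms(1) y(2) assms(5)] proj_closed(1)[OF z(1) assms(1) z(2) assms(5)]
  have "proj W (Gamma B W x a y a z) a w = proj W z a w \<ominus>\<^bsub>W\<^esub> proj W a x (proj W y a w)"
    using Gamma_transversal(3)[OF C_domains(1)[OF assms(1,1-4)] z(2) assms(5)]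
      proj_proj[OF assms(1) y(1) z(1) y(2) z(2) assms(5)] by (simp add: L_op_def)
  also have "proj W a x (proj W y a w) = proj W y a w \<ominus>\<^bsub>W\<^esub> proj W x a w"
    using proj_decomp(3)[OF x(1) assms(1) x(2) c(2)]
      proj_proj[OF assms(1) x(1) y(1) x(2) y(2) assms(5)] by simp
  finally show ?thesis using c by simp algebra
qed

section \<open>From projectors to the affine structure\<close>

text \<open>A submodule is the set of vectors fixed by its projector. Equations between points of
  \<open>C B W a a\<close> thereby become equations between vectors of \<open>W\<close>.\<close>

lemma C_eqI:
  assumes "a \<in> Gras B W" "x \<in> C B W a a" "y \<in> C B W a a"
    and "\<And>w. w \<in> carrier W \<Longrightarrow> proj W x a w = proj W y a w"
  shows "x = y"
proof -
  have "x \<subseteq> y" if x: "x \<in> C B W a a" and y: "y \<in> C B W a a"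
    and eq: "\<And>w. w \<in> carrier W \<Longrightarrow> proj W x a w = proj W y a w" for x y
  proof
    fix w assume w: "w \<in> x"
    note x = C_transversal[OF x] and y = C_transversal[OF y] and c = Gras_closed(1)[OF _ w]
    have "w = proj W y a w"
      using proj_id[OF x(1) assms(1) x(2) w] eq[OF c[OF x(1)]] by simp
    then show "w \<in> y" using proj_decomp(1)[OF y(1) assms(1) y(2) c[OF x(1)]] by simp
  qed
  then show ?thesis using assms(2-4) by (intro equalityI) simp_all
qed


text \<open>All axioms are verified on the projectors \<open>P\<^sub>x\<^sup>a\<close>. The vectors are the points of
  \<open>C\<^sub>a\<close> themselves, with an arbitrary origin \<open>e\<close>.\<close>

lemma affine_structure_at:
  assumes a: "a \<in> Gras B W" and e: "e \<in> C B W a a"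
  shows "is_affine_structure K (C B W a a)
    (\<lambda>y x z. Gamma B W x a y a z) (\<lambda>x s y. Pi_op K B W s x a y)"
proof -
  define G where "G = (\<lambda>x y z. Gamma B W x a y a z)"
  define S where "S = (\<lambda>s x y. Pi_op K B W s x a y)"
  define P where "P = (\<lambda>x. proj W x a)"
  let ?C = "C B W a a"
  \<comment> \<open>The origin \<open>e\<close> is the zero vector, and a point \<open>v\<close>
    stands for the translation that takes \<open>e\<close> to \<open>v\<close>.\<close>
  define V :: "('k, 'w set) module" where
    "V = \<lparr>carrier = ?C, monoid.mult = undefined, one = undefined, ring.zero = e, ring.add = \<lambda>x y. G x e y,
      module.smult = \<lambda>s x. S s e x\<rparr>"
  define act where "act = (\<lambda>v p. G v e p)"
  have act: "act v p = G v e p" for v p by (simp add: act_def)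
  have V: "carrier V = ?C" "\<zero>\<^bsub>V\<^esub> = e" "x \<oplus>\<^bsub>V\<^esub> y = G x e y" "s \<odot>\<^bsub>V\<^esub> x = S s e x" for x y s
    by (simp_all add: V_def)
  have Gc: "G x y z \<in> ?C" if "x \<in> ?C" "y \<in> ?C" "z \<in> ?C" for x y z
    unfolding G_def using Gamma_closed[OF a a that] .
  have Sc: "S s x y \<in> ?C" if "s \<in> carrier K" "x \<in> ?C" "y \<in> ?C" for s x y
    unfolding S_def using Pi_closed[OF a that(2,3,1)] .
  \<comment> \<open>With \<open>PG\<close>, \<open>PS\<close> and \<open>ext\<close>, each axiom
    turns into an identity between vectors of \<open>W\<close>, checked at one \<open>w\<close> at a
    time.\<close>
  have PG: "P (G x y z) w = (P x w \<ominus>\<^bsub>W\<^esub> P y w) \<oplus>\<^bsub>W\<^esub> P z w"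
    if "x \<in> ?C" "y \<in> ?C" "z \<in> ?C" "w \<in> carrier W" for x y z w
    unfolding G_def P_def using proj_Gamma[OF a that] .
  have PS: "P (S s x y) w = smul s (P y w \<ominus>\<^bsub>W\<^esub> P x w) \<oplus>\<^bsub>W\<^esub> P x w"
    if "s \<in> carrier K" "x \<in> ?C" "y \<in> ?C" "w \<in> carrier W" for s x y w
    unfolding S_def P_def using proj_Pi[OF a that(2,3,1,4)] .
  have Pc: "P x w \<in> carrier W" if "x \<in> ?C" "w \<in> carrier W" for x w
    unfolding P_def using proj_closed(1)[OF _ a _ that(2)] C_transversal[OF that(1)] by simp
  have ext: "x = y" if "x \<in> ?C" "y \<in> ?C" "\<And>w. w \<in> carrier W \<Longrightarrow> P x w = P y w" for x y
    using C_eqI[OF a that(1,2)] that(3) by (simp add: P_def)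
  have assoc: "G (G x e y) e z = G x e (G y e z)" if "x \<in> ?C" "y \<in> ?C" "z \<in> ?C" for x y z
  proof (rule ext)
    fix w assume w: "w \<in> carrier W"
    show "P (G (G x e y) e z) w = P (G x e (G y e z)) w"
      using that e w Pc[OF that(1) w] Pc[OF that(2) w] Pc[OF that(3) w] Pc[OF e w]
      by (simp add: PG Gc) algebra
  qed (use that e in \<open>simp_all add: Gc\<close>)
  have comm: "G x e y = G y e x" if "x \<in> ?C" "y \<in> ?C" for x y
    unfolding G_def using Gamma_reverse(2)[OF C_domains(2)[OF a a that(1) e that(2)]] .
  have zero: "G e e x = x" if "x \<in> ?C" for x
    unfolding G_def using Gamma_same_left[OF a a e that] .
  \<comment> \<open>The negative of \<open>x\<close> is its reflection in the origin,
    \<open>e - x + e\<close>.\<close>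
  have inv: "G (G e x e) e x = e" if "x \<in> ?C" for x
  proof (rule ext)
    fix w assume w: "w \<in> carrier W"
    show "P (G (G e x e) e x) w = P e w"
      using that e w Pc[OF that w] Pc[OF e w] by (simp add: PG Gc) algebra
  qed (use that e in \<open>simp_all add: Gc\<close>)
  have grp: "abelian_group V"
  proof (rule abelian_groupI, unfold V)
    show "\<exists>y\<in>?C. G y e x = e" if "x \<in> ?C" for x
      using inv[OF that] Gc[OF e that e] by blast
  qed (rule Gc[OF _ e] e assoc comm zero; assumption)+
  have mod: "module K V"
  proof (rule moduleI)
    show "cring K" ..
    show "abelian_group V" by (rule grp)
    fix s x assume "s \<in> carrier K" "x \<in> carrier V"
    then show "s \<odot>\<^bsub>V\<^esub> x \<in> carrier V" using Sc e by (simp add: V)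
  next
    fix s t x assume st: "s \<in> carrier K" "t \<in> carrier K" and "x \<in> carrier V"
    then have x: "x \<in> ?C" by (simp add: V)
    have "S (s \<oplus>\<^bsub>K\<^esub> t) e x = G (S s e x) e (S t e x)"
    proof (rule ext)
      fix w assume w: "w \<in> carrier W"
      \<comment> \<open>The displacement of \<open>x\<close> from the origin is kept as one vector,
        so that the laws of \<open>smul\<close> apply to it directly.\<close>
      define d where "d = P x w \<ominus>\<^bsub>W\<^esub> P e w"
      have d: "d \<in> carrier W" using Pc[OF x w] Pc[OF e w] by (simp add: d_def)
      show "P (S (s \<oplus>\<^bsub>K\<^esub> t) e x) w = P (G (S s e x) e (S t e x)) w"
        using st x e w Pc[OF e w] smul_closed[OF st(1) d] smul_closed[OF st(2) d]
        by (simp add: PG PS Sc smul_add_scalar d flip: d_def) algebra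
    qed (use st x e in \<open>simp_all add: Gc Sc\<close>)
    then show "(s \<oplus>\<^bsub>K\<^esub> t) \<odot>\<^bsub>V\<^esub> x = s \<odot>\<^bsub>V\<^esub> x \<oplus>\<^bsub>V\<^esub> t \<odot>\<^bsub>V\<^esub> x" by (simp add: V)
    have "S (s \<otimes>\<^bsub>K\<^esub> t) e x = S s e (S t e x)"
    proof (rule ext)
      fix w assume w: "w \<in> carrier W"
      define d where "d = P x w \<ominus>\<^bsub>W\<^esub> P e w"
      have d: "d \<in> carrier W" using Pc[OF x w] Pc[OF e w] by (simp add: d_def)
      \<comment> \<open>The displacement of the inner multiple \<open>S t e x\<close> from the
        origin, in the shape produced by \<open>PS\<close>.\<close>
      have "(smul t d \<oplus>\<^bsub>W\<^esub> P e w) \<ominus>\<^bsub>W\<^esub> P e w = smul t d"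
        using smul_closed[OF st(2) d] Pc[OF e w] by algebra
      then show "P (S (s \<otimes>\<^bsub>K\<^esub> t) e x) w = P (S s e (S t e x)) w"
        using st x e w by (simp add: PS Sc smul_mult d flip: d_def)
    qed (use st x e in \<open>simp_all add: Sc\<close>)
    then show "(s \<otimes>\<^bsub>K\<^esub> t) \<odot>\<^bsub>V\<^esub> x = s \<odot>\<^bsub>V\<^esub> (t \<odot>\<^bsub>V\<^esub> x)" by (simp add: V)
  next
    fix s x y assume s: "s \<in> carrier K" and "x \<in> carrier V" "y \<in> carrier V"
    then have x: "x \<in> ?C" and y: "y \<in> ?C" by (simp_all add: V)
    have "S s e (G x e y) = G (S s e x) e (S s e y)"
    proof (rule ext)
      fix w assume w: "w \<in> carrier W"
      define c d where "c = P x w \<ominus>\<^bsub>W\<^esub> P e w" and "d = P y w \<ominus>\<^bsub>W\<^esub> P e w"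
      have cd: "c \<in> carrier W" "d \<in> carrier W"
        using Pc[OF x w] Pc[OF y w] Pc[OF e w] by (simp_all add: c_def d_def)
      \<comment> \<open>The displacement of the sum \<open>G x e y\<close>, in the shape produced by
        \<open>PG\<close>; it is the sum of the two displacements.\<close>
      have "(c \<oplus>\<^bsub>W\<^esub> P y w) \<ominus>\<^bsub>W\<^esub> P e w = c \<oplus>\<^bsub>W\<^esub> d"
        unfolding d_def using cd(1) Pc[OF y w] Pc[OF e w] by algebra
      then show "P (S s e (G x e y)) w = P (G (S s e x) e (S s e y)) w"
        using s x y e w Pc[OF e w] smul_closed[OF s cd(1)] smul_closed[OF s cd(2)]
        by (simp add: PG PS Gc Sc linear_op_add[OF linear_op_smul] cd flip: c_def d_def) algebra
    qed (use s x y e in \<open>simp_all add: Gc Sc\<close>)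
    then show "s \<odot>\<^bsub>V\<^esub> (x \<oplus>\<^bsub>V\<^esub> y) = s \<odot>\<^bsub>V\<^esub> x \<oplus>\<^bsub>V\<^esub> s \<odot>\<^bsub>V\<^esub> y" by (simp add: V)
  next
    fix x assume "x \<in> carrier V"
    then have x: "x \<in> ?C" by (simp add: V)
    have "S \<one>\<^bsub>K\<^esub> e x = x"
    proof (rule ext)
      fix w assume w: "w \<in> carrier W"
      have "P (S \<one>\<^bsub>K\<^esub> e x) w = (P x w \<ominus>\<^bsub>W\<^esub> P e w) \<oplus>\<^bsub>W\<^esub> P e w"
        using x e w Pc[OF x w] Pc[OF e w] by (simp add: PS smul_one)
      also have "\<dots> = P x w" using Pc[OF x w] Pc[OF e w] by algebra
      finally show "P (S \<one>\<^bsub>K\<^esub> e x) w = P x w" .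
    qed (use x e in \<open>simp_all add: Sc\<close>)
    then show "\<one>\<^bsub>K\<^esub> \<odot>\<^bsub>V\<^esub> x = x" by (simp add: V)
  qed
  \<comment> \<open>The vector from \<open>p\<close> to \<open>q\<close> is \<open>q - p\<close>,
    attached to the origin \<open>e\<close> as the point \<open>G q p e\<close>.\<close>
  have act_iff: "act v p = q \<longleftrightarrow> v = G q p e" if "v \<in> ?C" "p \<in> ?C" "q \<in> ?C" for v p q
  proof
    assume q: "act v p = q"
    have "v = G (G v e p) p e"
    proof (rule ext)
      fix w assume w: "w \<in> carrier W"
      show "P v w = P (G (G v e p) p e) w"
        using that e w Pc[OF that(1) w] Pc[OF that(2) w] Pc[OF e w] by (simp add: PG Gc) algebra
    qed (use that e in \<open>simp_all add: Gc\<close>)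
    then show "v = G q p e" using q by (simp add: act)
  next
    assume v: "v = G q p e"
    have "G (G q p e) e p = q"
    proof (rule ext)
      fix w assume w: "w \<in> carrier W"
      show "P (G (G q p e) e p) w = P q w"
        using that e w Pc[OF that(2) w] Pc[OF that(3) w] Pc[OF e w] by (simp add: PG Gc) algebra
    qed (use that e in \<open>simp_all add: Gc\<close>)
    then show "act v p = q" using v by (simp add: act)
  qed
  have unique: "v \<in> ?C \<and> act v p = q \<longleftrightarrow> v = G q p e" if "p \<in> ?C" "q \<in> ?C" for v p q
    using act_iff[OF _ that] Gc[OF that(2,1) e] by blast
  have vec: "vec V act p q = G q p e" if "p \<in> ?C" "q \<in> ?C" for p q
    unfolding vec_def V unique[OF that] by simp
  have aff: "affine_space K V ?C act"
  proof (intro affine_space.intro affine_space_axioms.intro mod)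
    fix p q assume "p \<in> ?C" "q \<in> ?C"
    then show "\<exists>!v. v \<in> carrier V \<and> act v p = q"
      unfolding V by (simp add: unique)
  qed (use Gc e zero assoc in \<open>auto simp: V act\<close>)
  have sum: "G q p r = sum_at V act p q r" if "p \<in> ?C" "q \<in> ?C" "r \<in> ?C" for p q r
  proof -
    \<comment> \<open>On projectors the right side is \<open>(q - p) + (r - p) + p\<close>: the
      auxiliary origin \<open>e\<close> cancels, so the sum depends on \<open>p\<close>
      alone.\<close>
    have "G q p r = G (G (G q p e) e (G r p e)) e p"
    proof (rule ext)
      fix w assume w: "w \<in> carrier W"
      show "P (G q p r) w = P (G (G (G q p e) e (G r p e)) e p) w"
        using that e w Pc[OF that(1) w] Pc[OF that(2) w] Pc[OF that(3) w] Pc[OF e w]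
        by (simp add: PG Gc) algebra
    qed (use that e in \<open>simp_all add: Gc\<close>)
    then show ?thesis using that by (simp add: sum_at_def vec V act)
  qed
  have scale: "S s p q = scale_at V act p s q" if "p \<in> ?C" "s \<in> carrier K" "q \<in> ?C" for p s q
  proof -
    \<comment> \<open>Here too \<open>e\<close> cancels, leaving \<open>s\<close> times the
      displacement \<open>d\<close> of \<open>q\<close> from \<open>p\<close>, added to
      \<open>p\<close>.\<close>
    have "S s p q = G (S s e (G q p e)) e p"
    proof (rule ext)
      fix w assume w: "w \<in> carrier W"
      define d where "d = P q w \<ominus>\<^bsub>W\<^esub> P p w"
      have d: "d \<in> carrier W" using Pc[OF that(1) w] Pc[OF that(3) w] by (simp add: d_def)
      have "(d \<oplus>\<^bsub>W\<^esub> P e w) \<ominus>\<^bsub>W\<^esub> P e w = d" using d Pc[OF e w] by algebra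
      then show "P (S s p q) w = P (G (S s e (G q p e)) e p) w"
        using that e w Pc[OF that(1) w] Pc[OF e w] smul_closed[OF that(2) d]
        by (simp add: PG PS Gc Sc flip: d_def) algebra
    qed (use that e in \<open>simp_all add: Gc Sc\<close>)
    then show ?thesis using that by (simp add: scale_at_def vec V act)
  qed
  show ?thesis
    unfolding is_affine_structure_def
    using aff sum scale unfolding G_def S_def by blast
qed

end

text \<open>Without points there is no origin from which to build the vectors, so the zero module on
  the type of points is used, with \<open>undefined\<close> as its only element.\<close>

lemma is_affine_structure_empty:
  fixes K :: "('k, 'r) ring_scheme"
  assumes "cring K"
  shows "is_affine_structure K ({} :: 'p set) addition scaling"
proof -
  define V :: "('k, 'p) module" where
    "V = \<lparr>carrier = {undefined}, monoid.mult = undefined, one = undefined, ring.zero = undefined,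
      ring.add = \<lambda>_ _. undefined, module.smult = \<lambda>_ _. undefined\<rparr>"
  have "abelian_group V" by (rule abelian_groupI) (simp_all add: V_def)
  then have "module K V" by (intro moduleI assms) (simp_all add: V_def)
  then have "affine_space K V ({} :: 'p set) (\<lambda>_ p. p)"
    by (simp add: affine_space_def affine_space_axioms_def)
  then show ?thesis unfolding is_affine_structure_def by blast
qed

theorem theorem1p2:
  fixes K :: "('k, 'r) ring_scheme"
    and B :: "('k, 'b, 'n) module_scheme"
    and W :: "('b, 'w, 'm) module_scheme"
  assumes "cring K"
    and "assoc_unital_algebra K B"
    and "right_module B W"
  shows
    "(\<forall>a \<in> Gras B W. \<forall>b \<in> Gras B W.
        torsor (C B W a b) (U B W a b) \<and>
        (\<forall>y \<in> C B W a b.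
           group \<lparr>carrier = C B W a b, monoid.mult = (\<lambda>x z. Gamma B W x a y b z), one = y\<rparr>)) \<and>
     ((\<forall>x a y b z. (x, a, y, b, z) \<in> D_Gamma B W \<longrightarrow>
         (z, b, y, a, x) \<in> D_Gamma B W \<and> Gamma B W x a y b z = Gamma B W z b y a x) \<and>
      (\<forall>a \<in> Gras B W. \<forall>b \<in> Gras B W.
         C B W a b = C B W b a \<and>
         (\<forall>x \<in> C B W a b. \<forall>y \<in> C B W a b. \<forall>z \<in> C B W a b.
            U B W a b x y z = opposite (U B W b a) x y z)) \<and>
      (\<forall>a \<in> Gras B W. commutative_torsor (C B W a a) (U B W a a))) \<and>
     (\<forall>a \<in> Gras B W.
        is_affine_structure K (C B W a a)
          (\<lambda>y x z. Gamma B W x a y a z)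
          (\<lambda>x s y. Pi_op K B W s x a y))"
proof -
  interpret right_module B W by fact
  have geometry: "module_over_algebra K B W"
    using assms by (simp add: module_over_algebra_def)
  show ?thesis
  proof (intro conjI ballI allI impI)
    fix a b y assume ab: "a \<in> Gras B W" "b \<in> Gras B W" and y: "y \<in> C B W a b"
    show "group \<lparr>carrier = C B W a b, monoid.mult = (\<lambda>x z. Gamma B W x a y b z), one = y\<rparr>"
      using torsor.group_at[OF torsor_U[OF ab] y] by (simp add: U_def)
  next
    fix a assume a: "a \<in> Gras B W"
    show "is_affine_structure K (C B W a a)
      (\<lambda>y x z. Gamma B W x a y a z) (\<lambda>x s y. Pi_op K B W s x a y)"
    \<comment> \<open>A nonempty set supplies the origin that \<open>affine_structure_at\<close>
      requires.\<close>
    proof (cases "C B W a a = {}")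
      case True
      then show ?thesis using is_affine_structure_empty[OF assms(1)] by simp
    next
      case False
      then show ?thesis using module_over_algebra.affine_structure_at[OF geometry a] by blast
    qed
  qed (rule torsor_U Gamma_reverse C_commute U_opposite commutative_torsor_U; assumption)+
qed

end
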